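(* Let $\mathcal{S}=\{1,\ldots,S\}$ and let $Q(\cdot)$ be a nonlinear generator on $\mathcal{P}(\mathcal{S})$. Assume that $Q(m)$ is irreducible for all $m\in\mathcal{P}(\mathcal{S})$, and let $x(m)$ denote the unique point of $\mathcal{P}(\mathcal{S})$ with $0=x(m)^TQ(m)$. Furthermore, assume that $f(m):=x(m)-m$ is continuously differentiable (i.e. $f:\mathcal{P}(\mathcal{S})\to\mathbb{R}^S$ is the restriction of a continuously differentiable function, also denoted by $f$, on an open neighbourhood of $\mathcal{P}(\mathcal{S})$ in $\mathbb{R}^S$) and that the $(S-1)\times(S-1)$ matrix $$M(m) := \begin{pmatrix} \frac{\partial f_1(m)}{\partial m_1} & \ldots & \frac{\partial f_1(m)}{\partial m_{S-1}} \\ \vdots & \ddots & \vdots \\ \frac{\partial f_{S-1}(m)}{\partial m_1} & \ldots & \frac{\partial f_{S-1}(m)}{\partial m_{S-1}} \end{pmatrix} - \begin{pmatrix} \frac{\partial f_1(m)}{\partial m_S} & \ldots & \frac{\partial f_1(m)}{\partial m_S} \\ \vdots & \ddots & \vdots \\ \frac{\partial f_{S-1}(m)}{\partial m_S} & \ldots & \frac{\partial f_{S-1}(m)}{\partial m_S} \end{pmatrix}$$ is non-singular for all $m\in\mathcal{P}(\mathcal{S})$. Then there is a unique invariant distribution, that is, there is exactly one $m\in\mathcal{P}(\mathcal{S})$ with $0=m^TQ(m)$.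
   Context: $\mathcal{P}(\mathcal{S})=\{m\in\mathbb{R}^S: m_i\ge 0,\ \sum_{i\in\mathcal{S}}m_i=1\}$ is the probability simplex over the finite state space $\mathcal{S}=\{1,\ldots,S\}$. A transition rate matrix is a real $S\times S$ matrix with non-negative off-diagonal entries and all row sums equal to $0$ (conservative). A transition rate matrix function is a map $Q:\mathcal{P}(\mathcal{S})\to\mathbb{R}^{S\times S}$ such that $Q(m)$ is a transition rate matrix for every $m\in\mathcal{P}(\mathcal{S})$. If $Q(m)$ is irreducible (as the generator of a classical continuous time Markov chain), there is exactly one $x\in\mathcal{P}(\mathcal{S})$ with $0=x^TQ(m)$. A continuous family of nonlinear transition probabilities is a family of stochastic matrices $P(t,m)=(P_{ij}(t,m))_{i,j\in\mathcal{S}}$ depending continuously on $t\ge 0$ and $m\in\mathcal{P}(\mathcal{S})$ and satisfying the nonlinear Chapman-Kolmogorov equation $\sum_i m_iP_{ij}(t+s,m)=\sum_{i,k}m_iP_{ik}(t,m)P_{kj}(s,\sum_l m_lP_l(t,m))$, where $P_l(t,m)$ denotes the $l$-th row. It yields a nonlinear Markov semigroup $(\Phi^t(\cdot))_{t\ge0}$ of continuous transformations of $\mathcal{P}(\mathcal{S})$ via $\Phi^t_j(m)=\sum_i m_iP_{ij}(t,m)$; it satisfies $\Phi^{t+s}=\Phi^t\Phi^s$ and $\Phi^0(m)=m$. $\Phi^t(m_0)$ is the marginal distribution at time $t$ of the nonlinear Markov chain with initial distribution $m_0$. A transition rate matrix function $Q$ is the nonlinear (infinitesimal) generator of the semigroup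 if $\Phi^t(m)$ is differentiable in $t=0$ for all $m\in\mathcal{P}(\mathcal{S})$ and $\left.\frac{\partial}{\partial t}\Phi^t_j(m)\right|_{t=0}=\sum_i m_iQ_{ij}(m)$ for all $j\in\mathcal{S}$ and $m\in\mathcal{P}(\mathcal{S})$. $m\in\mathcal{P}(\mathcal{S})$ is an invariant distribution if $\left.\frac{\partial}{\partial t}\Phi^t(m)\right|_{t=0}=0$; equivalently, if $0=m^TQ(m)$. *)

theory Defs
  imports "Jordan_Normal_Form.Matrix" "HOL-Analysis.Analysis"
begin

no_notation Matrix.vec_index (infixl \<open>$\<close> 100)

text \<open>
  The state space \<open>{1,...,S}\<close> is a finite type \<open>'s\<close> with \<open>S = CARD('s)\<close>. Where the numbering of the
  states matters, it is given by a bijection from \<open>{1..CARD('s)}\<close> to \<open>'s\<close>.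
\<close>

definition prob_simplex :: "(real ^ 's) set" where
  "prob_simplex = {m. (\<forall>i. 0 \<le> m $ i) \<and> (\<Sum>i\<in>UNIV. m $ i) = 1}"

definition transition_rate_matrix :: "real ^ 's ^ 's \<Rightarrow> bool" where
  "transition_rate_matrix A \<longleftrightarrow>
     (\<forall>i j. i \<noteq> j \<longrightarrow> 0 \<le> A $ i $ j) \<and> (\<forall>i. (\<Sum>j\<in>UNIV. A $ i $ j) = 0)"

definition stochastic_matrix :: "real ^ 's ^ 's \<Rightarrow> bool" where
  "stochastic_matrix A \<longleftrightarrow>
     (\<forall>i j. 0 \<le> A $ i $ j) \<and> (\<forall>i. (\<Sum>j\<in>UNIV. A $ i $ j) = 1)"

text \<open>Every state leads to every other state along jumps of positive rate.\<close>

definition irreducible_generator :: "real ^ 's ^ 's \<Rightarrow> bool" where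
  "irreducible_generator A \<longleftrightarrow> (\<forall>i j. (i, j) \<in> {(k, l). k \<noteq> l \<and> 0 < A $ k $ l}\<^sup>*)"

text \<open>Only meaningful if \<open>A\<close> has exactly one stationary distribution, as irreducible generators do.\<close>

definition stationary_distribution :: "real ^ 's ^ 's \<Rightarrow> real ^ 's" where
  "stationary_distribution A = (THE x. x \<in> prob_simplex \<and> 0 = x v* A)"

definition marginal_flow ::
    "(real \<Rightarrow> real ^ 's \<Rightarrow> real ^ 's ^ 's) \<Rightarrow> real \<Rightarrow> real ^ 's \<Rightarrow> real ^ 's" where
  "marginal_flow P t m = (\<chi> j. \<Sum>i\<in>UNIV. m $ i * P t m $ i $ j)"

text \<open>
  The last condition, \<open>\<Phi>\<^sup>0(m) = m\<close>, is part of the notion of a semigroup and does not follow from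
  the Chapman-Kolmogorov equation, which only makes \<open>\<Phi>\<^sup>0\<close> idempotent.
\<close>

definition nonlinear_transition_probs ::
    "(real \<Rightarrow> real ^ 's \<Rightarrow> real ^ 's ^ 's) \<Rightarrow> bool" where
  "nonlinear_transition_probs P \<longleftrightarrow>
     (\<forall>t\<ge>0. \<forall>m\<in>prob_simplex. stochastic_matrix (P t m)) \<and>
     continuous_on ({0..} \<times> prob_simplex) (\<lambda>(t, m). P t m) \<and>
     (\<forall>t\<ge>0. \<forall>s\<ge>0. \<forall>m\<in>prob_simplex. \<forall>j.
        (\<Sum>i\<in>UNIV. m $ i * P (t + s) m $ i $ j) =
        (\<Sum>i\<in>UNIV. \<Sum>k\<in>UNIV. m $ i * P t m $ i $ k * P s (marginal_flow P t m) $ k $ j)) \<and>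
     (\<forall>m\<in>prob_simplex. marginal_flow P 0 m = m)"

definition is_nonlinear_generator ::
    "(real \<Rightarrow> real ^ 's \<Rightarrow> real ^ 's ^ 's) \<Rightarrow> (real ^ 's \<Rightarrow> real ^ 's ^ 's) \<Rightarrow> bool" where
  "is_nonlinear_generator P Q \<longleftrightarrow>
     (\<forall>m\<in>prob_simplex. transition_rate_matrix (Q m)) \<and>
     (\<forall>m\<in>prob_simplex. \<forall>j.
        ((\<lambda>t. marginal_flow P t m $ j) has_real_derivative (\<Sum>i\<in>UNIV. m $ i * Q m $ i $ j))
          (at 0 within {0..}))"

definition invariant_distribution ::
    "(real \<Rightarrow> real ^ 's \<Rightarrow> real ^ 's ^ 's) \<Rightarrow> real ^ 's \<Rightarrow> bool" where
  "invariant_distribution P m \<longleftrightarrow>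
     m \<in> prob_simplex \<and>
     ((\<lambda>t. marginal_flow P t m) has_vector_derivative 0) (at 0 within {0..})"

definition continuously_differentiable_on ::
    "(real ^ 's \<Rightarrow> real ^ 's) \<Rightarrow> (real ^ 's) set \<Rightarrow> bool" where
  "continuously_differentiable_on f U \<longleftrightarrow>
     (\<forall>m\<in>U. f differentiable (at m)) \<and> continuous_on U (\<lambda>m. jacobian f (at m))"

text \<open>
  The \<open>(S-1) \<times> (S-1)\<close> matrix with entries \<open>\<partial>f\<^sub>i/\<partial>m\<^sub>j - \<partial>f\<^sub>i/\<partial>m\<^sub>S\<close> for \<open>1 \<le> i, j \<le> S - 1\<close>, where
  \<open>st i\<close> is the \<open>i\<close>-th state; \<open>Matrix.mat\<close> counts rows and columns from \<open>0\<close>. For \<open>S = 1\<close> it is the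
  empty matrix, which is invertible.
\<close>

definition reduced_jacobian ::
    "(nat \<Rightarrow> 's) \<Rightarrow> (real ^ 's \<Rightarrow> real ^ 's) \<Rightarrow> real ^ 's \<Rightarrow> real Matrix.mat" where
  "reduced_jacobian st f m =
     (let S = CARD('s); J = jacobian f (at m) in
      Matrix.mat (S - 1) (S - 1)
        (\<lambda>(i, j). J $ st (i + 1) $ st (j + 1) - J $ st (i + 1) $ st S))"

end

theory Submission
  imports Defs
begin

text \<open>
  Write \<open>x(m)\<close> for the stationary distribution of \<open>Q(m)\<close>. The invariant distributions are the fixed
  points of \<open>x\<close>, that is the zeros of \<open>f = x - id\<close> on the simplex, so the theorem is a fixed point
  theorem in the style of Kellogg: irreducibility makes \<open>x\<close> map the simplex into its relative
  interior, and non-singularity of \<open>M\<close> says that the differential of \<open>f\<close> is injective on the tangent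
  space of the simplex. As the simplex is connected, the determinants involved have constant sign, so
  all zeros of \<open>f\<close> have the same index; the indices add up to 1, hence there is exactly one zero.

  Degree theory enters through one integral identity. If \<open>W\<close> is a \<open>C\<^sup>1\<close> map of \<open>\<real>\<^sup>n\<close> vanishing outside
  a box \<open>B\<close> and \<open>\<psi>\<close> is continuous, then
  \<open>\<integral>\<^sub>B \<psi>(m - W m) det(I - DW m) dm = \<integral>\<^sub>B \<psi>\<close> (\<open>integral_id_minus_perturbation\<close>).
  The proof is the idea of Milnor and Rogers: for polynomial \<open>\<psi>\<close> the left-hand side, with \<open>W\<close> replaced
  by \<open>t W\<close>, is a polynomial in \<open>t\<close>; for small \<open>t > 0\<close> the map \<open>id - t W\<close> is a diffeomorphism of \<open>B\<close>
  onto itself and the identity is the change of variables formula; so the polynomial is constant and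
  \<open>t = 1\<close> gives the claim. The Stone-Weierstrass theorem passes to continuous \<open>\<psi>\<close>.

  Taking for \<open>\<psi>\<close> a bump of small support around \<open>y\<close> shows that a value \<open>y\<close> at whose preimages under
  \<open>id - W\<close> the Jacobian determinant has constant sign has exactly one preimage: each preimage
  contributes plus or minus the integral of the bump, with the same sign for all of them, and the sum
  of the contributions is the integral of the bump (\<open>unique_preimage_of_constant_sign\<close>).

  To apply this, \<open>W\<close> is built from \<open>x - c\<close>, where \<open>c\<close> is one of the values of \<open>x\<close>, by a cutoff and by
  an extension in the direction transversal to the simplex, such that the preimages of \<open>c\<close> under
  \<open>id - W\<close> are exactly the fixed points of \<open>x\<close> (\<open>unique_zero_on_prob_simplex\<close>).
\<close>

section \<open>Functions polynomial in a parameter\<close>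

text \<open>
  The family \<open>h t m\<close> is polynomial in the parameter \<open>t\<close>, with degree bounded uniformly in \<open>m \<in> B\<close> and
  with coefficients that are continuous in \<open>m \<in> B\<close>.
\<close>

definition poly_family :: "'a::topological_space set \<Rightarrow> (real \<Rightarrow> 'a \<Rightarrow> real) \<Rightarrow> bool" where
  "poly_family B h \<longleftrightarrow>
     (\<exists>p N. (\<forall>m\<in>B. degree (p m) \<le> N \<and> (\<forall>t. h t m = poly (p m) t)) \<and>
            (\<forall>k. continuous_on B (\<lambda>m. Polynomial.coeff (p m) k)))"

lemma poly_familyI:
  assumes "\<And>m t. m \<in> B \<Longrightarrow> h t m = poly (p m) t" "\<And>m. m \<in> B \<Longrightarrow> degree (p m) \<le> N"
    and "\<And>k. continuous_on B (\<lambda>m. Polynomial.coeff (p m) k)"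
  shows "poly_family B h"
  using assms unfolding poly_family_def by blast

lemma poly_family_continuous:
  assumes "continuous_on B a"
  shows "poly_family B (\<lambda>t. a)"
proof (rule poly_familyI[where p = "\<lambda>m. [:a m:]" and N = 0])
  show "continuous_on B (\<lambda>m. Polynomial.coeff [:a m:] k)" for k
    using assms by (cases k) auto
qed auto

lemma poly_family_parameter: "poly_family B (\<lambda>t m. t)"
  by (rule poly_familyI[where p = "\<lambda>m. [:0, 1:]" and N = 1]) auto

lemma poly_family_add:
  assumes "poly_family B g" "poly_family B h"
  shows "poly_family B (\<lambda>t m. g t m + h t m)"
proof -
  obtain p M where p: "\<And>m t. m \<in> B \<Longrightarrow> g t m = poly (p m) t" "\<And>m. m \<in> B \<Longrightarrow> degree (p m) \<le> M"
    "\<And>k. continuous_on B (\<lambda>m. Polynomial.coeff (p m) k)"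
    using assms(1) unfolding poly_family_def by blast
  obtain q N where q: "\<And>m t. m \<in> B \<Longrightarrow> h t m = poly (q m) t" "\<And>m. m \<in> B \<Longrightarrow> degree (q m) \<le> N"
    "\<And>k. continuous_on B (\<lambda>m. Polynomial.coeff (q m) k)"
    using assms(2) unfolding poly_family_def by blast
  show ?thesis
  proof (rule poly_familyI[where p = "\<lambda>m. p m + q m" and N = "max M N"])
    show "degree (p m + q m) \<le> max M N" if "m \<in> B" for m
      using p(2)[OF that] q(2)[OF that] degree_add_le_max[of "p m" "q m"] by linarith
    show "continuous_on B (\<lambda>m. Polynomial.coeff (p m + q m) k)" for k
      using p(3)[of k] q(3)[of k] by (simp add: continuous_on_add)
  qed (use p q in auto)
qed

lemma poly_family_mult:
  assumes "poly_family B g" "poly_family B h"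
  shows "poly_family B (\<lambda>t m. g t m * h t m)"
proof -
  obtain p M where p: "\<And>m t. m \<in> B \<Longrightarrow> g t m = poly (p m) t" "\<And>m. m \<in> B \<Longrightarrow> degree (p m) \<le> M"
    "\<And>k. continuous_on B (\<lambda>m. Polynomial.coeff (p m) k)"
    using assms(1) unfolding poly_family_def by blast
  obtain q N where q: "\<And>m t. m \<in> B \<Longrightarrow> h t m = poly (q m) t" "\<And>m. m \<in> B \<Longrightarrow> degree (q m) \<le> N"
    "\<And>k. continuous_on B (\<lambda>m. Polynomial.coeff (q m) k)"
    using assms(2) unfolding poly_family_def by blast
  show ?thesis
  proof (rule poly_familyI[where p = "\<lambda>m. p m * q m" and N = "M + N"])
    show "degree (p m * q m) \<le> M + N" if "m \<in> B" for m
      using p(2)[OF that] q(2)[OF that] degree_mult_le[of "p m" "q m"] by linarith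
    show "continuous_on B (\<lambda>m. Polynomial.coeff (p m * q m) k)" for k
      unfolding coeff_mult by (intro continuous_intros p(3) q(3))
  qed (use p q in auto)
qed

lemma poly_family_sum:
  assumes "\<And>i. i \<in> I \<Longrightarrow> poly_family B (h i)"
  shows "poly_family B (\<lambda>t m. \<Sum>i\<in>I. h i t m)"
  using assms
proof (induction I rule: infinite_finite_induct)
  case (insert i I)
  then show ?case by (simp add: poly_family_add)
qed (simp_all add: poly_family_continuous)

lemma poly_family_prod:
  assumes "\<And>i. i \<in> I \<Longrightarrow> poly_family B (h i)"
  shows "poly_family B (\<lambda>t m. \<Prod>i\<in>I. h i t m)"
  using assms
proof (induction I rule: infinite_finite_induct)
  case (insert i I)
  then show ?case by (simp add: poly_family_mult)
qed (simp_all add: poly_family_continuous)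

lemma poly_family_det:
  fixes M :: "real \<Rightarrow> 'a::topological_space \<Rightarrow> real^'n^'n"
  assumes "\<And>i j. poly_family B (\<lambda>t m. M t m $ i $ j)"
  shows "poly_family B (\<lambda>t m. det (M t m))"
  unfolding det_def
  by (intro poly_family_sum poly_family_mult poly_family_prod poly_family_continuous assms) auto

lemma poly_family_real_polynomial:
  fixes v w :: "'a::topological_space \<Rightarrow> 'b::real_normed_vector"
  assumes "real_polynomial_function q" and v: "continuous_on B v" and w: "continuous_on B w"
  shows "poly_family B (\<lambda>t m. q (v m + t *\<^sub>R w m))"
  using assms(1)
proof induction
  case (linear q)
  then interpret bounded_linear q .
  show ?case
    unfolding add scaleR real_scaleR_def
    by (intro poly_family_add poly_family_mult poly_family_continuous poly_family_parameter
        continuous_on v w)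
qed (auto intro: poly_family_continuous poly_family_add poly_family_mult)

lemma poly_family_integral:
  assumes "poly_family (cbox a b) h"
  obtains P where "\<And>t. integral (cbox a b) (h t) = poly P t"
proof -
  let ?B = "cbox a b"
  obtain p N where p: "\<And>m t. m \<in> ?B \<Longrightarrow> h t m = poly (p m) t" "\<And>m. m \<in> ?B \<Longrightarrow> degree (p m) \<le> N"
    "\<And>k. continuous_on ?B (\<lambda>m. Polynomial.coeff (p m) k)"
    using assms unfolding poly_family_def by blast
  define P where "P = (\<Sum>k\<le>N. Polynomial.monom (integral ?B (\<lambda>m. Polynomial.coeff (p m) k)) k)"
  have "integral ?B (h t) = poly P t" for t
  proof -
    have "integral ?B (h t) = integral ?B (\<lambda>m. \<Sum>k\<le>N. Polynomial.coeff (p m) k * t ^ k)"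
    proof (rule integral_cong)
      show "h t m = (\<Sum>k\<le>N. Polynomial.coeff (p m) k * t ^ k)" if "m \<in> ?B" for m
        unfolding p(1)[OF that] poly_altdef
        by (rule sum.mono_neutral_left) (use p(2)[OF that] in \<open>simp_all add: coeff_eq_0\<close>)
    qed
    also have "\<dots> = (\<Sum>k\<le>N. integral ?B (\<lambda>m. Polynomial.coeff (p m) k * t ^ k))"
      by (rule integral_sum) (auto intro!: integrable_continuous continuous_intros p(3))
    also have "\<dots> = poly P t"
      unfolding P_def by (simp add: poly_sum poly_monom)
    finally show ?thesis .
  qed
  then show ?thesis by (rule that)
qed

lemma poly_constant_near_0:
  fixes P :: "real poly"
  assumes "0 < e" "\<And>t. 0 < t \<Longrightarrow> t < e \<Longrightarrow> poly P t = c"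
  shows "poly P t = c"
proof -
  have "infinite {x. poly (P - [:c:]) x = 0}"
    by (rule infinite_super[of "{0<..<e}"]) (use assms infinite_Ioo[of 0 e] in \<open>simp_all add: subset_iff\<close>)
  then have "P - [:c:] = 0"
    using poly_roots_finite by blast
  then show ?thesis by simp
qed

section \<open>Compactly supported perturbations of the identity\<close>

lemma continuous_on_matrix:
  fixes D :: "'a::topological_space \<Rightarrow> real^'n \<Rightarrow> real^'k"
  assumes "\<And>h. continuous_on S (\<lambda>m. D m h)"
  shows "continuous_on S (\<lambda>m. matrix (D m))"
  unfolding matrix_def by (intro continuous_intros assms)

text \<open>
  The change of variables theorem for scalar integrands, which are regarded as vectors with one
  component.
\<close>

lemma change_of_variables_real:
  fixes \<phi> :: "real^'n::{finite,wellorder} \<Rightarrow> real" and g :: "real^'n::_ \<Rightarrow> real^'n::_"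
  assumes S: "S \<in> sets lebesgue"
    and der: "\<And>x. x \<in> S \<Longrightarrow> (g has_derivative g' x) (at x within S)"
    and inj: "inj_on g S"
    and abs: "(\<lambda>x. \<bar>det (matrix (g' x))\<bar> * \<phi> (g x)) absolutely_integrable_on S"
  shows "integral S (\<lambda>x. \<bar>det (matrix (g' x))\<bar> * \<phi> (g x)) = integral (g ` S) \<phi>"
    and "\<phi> absolutely_integrable_on (g ` S)"
proof -
  let ?b = "integral S (\<lambda>x. \<bar>det (matrix (g' x))\<bar> * \<phi> (g x))"
  have "(\<lambda>x. \<bar>det (matrix (g' x))\<bar> *\<^sub>R (vec (\<phi> (g x)) :: real^1)) absolutely_integrable_on S"
    using abs by (simp add: absolutely_integrable_on_1_iff)
  moreover have "integral S (\<lambda>x. \<bar>det (matrix (g' x))\<bar> *\<^sub>R (vec (\<phi> (g x)) :: real^1)) = vec ?b"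
    by (simp add: integral_on_1_eq)
  ultimately have "(\<lambda>x. vec (\<phi> x) :: real^1) absolutely_integrable_on (g ` S) \<and>
      integral (g ` S) (\<lambda>x. vec (\<phi> x) :: real^1) = vec ?b"
    using has_absolute_integral_change_of_variables[OF S der inj, of "\<lambda>x. vec (\<phi> x) :: real^1" "vec ?b"]
    by simp
  then show "?b = integral (g ` S) \<phi>" "\<phi> absolutely_integrable_on (g ` S)"
    by (simp_all add: absolutely_integrable_on_1_iff integral_on_1_eq vec_eq_iff)
qed

lemma continuous_on_det:
  fixes A :: "'a::topological_space \<Rightarrow> real^'n^'n"
  assumes "continuous_on S A"
  shows "continuous_on S (\<lambda>m. det (A m))"
  unfolding det_def by (intro continuous_intros assms)

lemma det_id_minus_contraction_pos:
  fixes D :: "real^'n \<Rightarrow> real^'n"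
  assumes "linear D" and D: "\<And>h. norm (D h) \<le> L * norm h" and "L < 1"
  shows "0 < det (matrix (\<lambda>h. h - D h))"
proof -
  interpret linear D by fact
  define d where "d s = det (matrix (\<lambda>h. h - s *\<^sub>R D h))" for s
  \<comment> \<open>\<open>d\<close> has no zero on \<open>[0, 1]\<close>, so it keeps the sign of \<open>d 0 = 1\<close>\<close>
  have lin: "linear (\<lambda>h. h - s *\<^sub>R D h)" for s
    by (intro linear_compose_sub linear_ident linear_compose_scale_right \<open>linear D\<close>)
  have cont: "continuous_on UNIV d"
    unfolding d_def by (intro continuous_on_det continuous_on_matrix continuous_intros)
  have nz: "d s \<noteq> 0" if "0 \<le> s" "s \<le> 1" for s
  proof -
    have "h = 0" if h: "h - s *\<^sub>R D h = 0" for h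
    proof (rule ccontr)
      assume "h \<noteq> 0"
      have "norm h = s * norm (D h)"
        using h \<open>0 \<le> s\<close> by (metis abs_of_nonneg eq_iff_diff_eq_0 norm_scaleR)
      also have "\<dots> \<le> 1 * norm (D h)"
        by (rule mult_right_mono) (use \<open>s \<le> 1\<close> in auto)
      also have "\<dots> \<le> L * norm h"
        using D[of h] by simp
      also have "\<dots> < 1 * norm h"
        by (rule mult_strict_right_mono) (use \<open>L < 1\<close> \<open>h \<noteq> 0\<close> in auto)
      finally show False by simp
    qed
    then have "inj (\<lambda>h. h - s *\<^sub>R D h)"
      using lin linear_injective_0 by blast
    then show ?thesis
      unfolding d_def using det_nz_iff_inj[OF lin] by blast
  qed
  have "d 0 = 1"
    unfolding d_def by (simp add: matrix_id_mat_1[unfolded id_def])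
  have "0 < d 1"
  proof (rule ccontr)
    assume "\<not> 0 < d 1"
    then have "\<exists>s. 0 \<le> s \<and> s \<le> 1 \<and> d s = 0"
      using \<open>d 0 = 1\<close> continuous_on_subset[OF cont] by (intro IVT2') auto
    then show False using nz by blast
  qed
  then show ?thesis by (simp add: d_def)
qed

text \<open>
  The set \<open>B\<close> is arbitrary: outside it the map is the identity, so injectivity keeps \<open>B\<close> and its
  complement apart.
\<close>

lemma bij_betw_id_minus_contraction:
  fixes W :: "'a::{real_normed_vector,complete_space} \<Rightarrow> 'a"
  assumes lip: "\<And>x y. norm (W x - W y) \<le> L * norm (x - y)" and "0 \<le> L" "L < 1"
    and supp: "\<And>m. m \<notin> B \<Longrightarrow> W m = 0"
  shows "bij_betw (\<lambda>m. m - W m) B B"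
proof -
  have inj: "x = y" if "x - W x = y - W y" for x y
  proof (rule ccontr)
    assume "x \<noteq> y"
    have "x - y = W x - W y"
      using that by (simp add: algebra_simps)
    then have "norm (x - y) \<le> L * norm (x - y)"
      using lip[of x y] by simp
    also have "\<dots> < 1 * norm (x - y)"
      by (rule mult_strict_right_mono) (use \<open>L < 1\<close> \<open>x \<noteq> y\<close> in auto)
    finally show False by simp
  qed
  have into: "m - W m \<in> B" if "m \<in> B" for m
  proof (rule ccontr)
    assume out: "m - W m \<notin> B"
    then have "m - W m - W (m - W m) = m - W m"
      using supp by simp
    then show False using inj out \<open>m \<in> B\<close> by metis
  qed
  have onto: "\<exists>m\<in>B. m - W m = y" if "y \<in> B" for y
  proof -
    \<comment> \<open>Banach's fixed point theorem on the whole space; the solution lies in \<open>B\<close> since \<open>W\<close> vanishes elsewhere\<close>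
    have "\<exists>!m. y + W m = m"
      by (rule banach_fix_type[OF \<open>0 \<le> L\<close> \<open>L < 1\<close>]) (use lip in \<open>auto simp: dist_norm\<close>)
    then obtain m where "y + W m = m" by blast
    then have m: "m - W m = y" by (metis add_diff_cancel_right')
    then show ?thesis using supp \<open>y \<in> B\<close> by (metis diff_zero)
  qed
  show ?thesis
  proof (rule bij_betw_imageI)
    show "inj_on (\<lambda>m. m - W m) B"
      by (rule inj_onI) (rule inj)
    show "(\<lambda>m. m - W m) ` B = B"
      using into onto by blast
  qed
qed

lemma C1_compact_support_lipschitz:
  fixes W :: "'a::euclidean_space \<Rightarrow> 'b::euclidean_space"
  assumes der: "\<And>m. (W has_derivative D m) (at m)"
    and cont: "\<And>h. continuous_on UNIV (\<lambda>m. D m h)"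
    and "compact B" and supp: "\<And>m. m \<notin> B \<Longrightarrow> W m = 0"
  obtains L where "0 < L" "\<And>m h. norm (D m h) \<le> L * norm h"
    "\<And>x y. norm (W x - W y) \<le> L * norm (x - y)"
proof -
  define b where "b m = (\<Sum>i\<in>Basis. norm (D m i))" for m
  have "continuous_on B b"
    unfolding b_def by (intro continuous_intros continuous_on_subset[OF cont]) auto
  then obtain L where L: "0 < L" "\<And>m. m \<in> B \<Longrightarrow> norm (b m) \<le> L"
    using compact_continuous_image[OF _ \<open>compact B\<close>] compact_imp_bounded bounded_pos
    by (metis image_eqI)
  have D_le: "onorm (D m) \<le> L" for m
  proof (cases "m \<in> B")
    case True
    then show ?thesis
      using onorm_componentwise[OF has_derivative_bounded_linear[OF der], of m] L(2)[OF True]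
      by (simp add: b_def)
  next
    case False
    have "(W has_derivative (\<lambda>h. 0)) (at m)"
      by (rule has_derivative_transform_within_open[where s = "- B" and f = "\<lambda>_. 0"])
        (use False \<open>compact B\<close> supp in \<open>auto simp: compact_imp_closed open_Compl\<close>)
    then have "D m = (\<lambda>h. 0)"
      using der has_derivative_unique by blast
    then show ?thesis using L(1) by (simp add: onorm_zero)
  qed
  have 1: "norm (D m h) \<le> L * norm h" for m h
    using onorm[OF has_derivative_bounded_linear[OF der]] D_le
    by (meson mult_right_mono norm_ge_zero order_trans)
  have 2: "norm (W x - W y) \<le> L * norm (x - y)" for x y
    by (rule differentiable_bound[where S = UNIV]) (use der D_le in auto)
  show ?thesis
    using that[OF L(1) 1 2] .
qed

lemma continuous_on_integrand:
  fixes W :: "real^'n \<Rightarrow> real^'n"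
  assumes der: "\<And>m. (W has_derivative D m) (at m)"
    and cont: "\<And>h. continuous_on UNIV (\<lambda>m. D m h)"
    and \<psi>: "continuous_on UNIV \<psi>"
  shows "continuous_on S (\<lambda>m. \<psi> (m - W m) * det (matrix (\<lambda>h. h - D m h)))"
proof -
  have W: "continuous_on UNIV W"
    using der has_derivative_continuous_on by (metis has_derivative_at_withinI)
  have "continuous_on UNIV (\<lambda>m. \<psi> (m - W m))"
    by (rule continuous_on_compose2[OF \<psi>]) (auto intro!: continuous_intros W)
  then have "continuous_on UNIV (\<lambda>m. \<psi> (m - W m) * det (matrix (\<lambda>h. h - D m h)))"
    by (intro continuous_on_mult continuous_on_det continuous_on_matrix continuous_on_diff
        continuous_on_const cont)
  then show ?thesis by (rule continuous_on_subset) auto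
qed

lemma absolutely_integrable_continuous_UNIV:
  fixes f :: "'a::euclidean_space \<Rightarrow> 'b::euclidean_space"
  shows "continuous_on UNIV f \<Longrightarrow> f absolutely_integrable_on cbox a b"
  by (rule absolutely_integrable_continuous) (auto intro: continuous_on_subset)

lemma integral_id_minus_small_perturbation:
  fixes W :: "real^'n::{finite,wellorder} \<Rightarrow> real^'n::_"
  assumes der: "\<And>m. (W has_derivative D m) (at m)"
    and cont: "\<And>h. continuous_on UNIV (\<lambda>m. D m h)"
    and supp: "\<And>m. m \<notin> cbox a b \<Longrightarrow> W m = 0"
    and \<psi>: "continuous_on UNIV (\<psi> :: real^'n::_ \<Rightarrow> real)"
    and DL: "\<And>m h. norm (D m h) \<le> L * norm h"
    and WL: "\<And>x y. norm (W x - W y) \<le> L * norm (x - y)" and "0 \<le> L" "L < 1"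
  shows "integral (cbox a b) (\<lambda>m. \<psi> (m - W m) * det (matrix (\<lambda>h. h - D m h)))
       = integral (cbox a b) \<psi>"
proof -
  let ?B = "cbox a b" and ?G = "\<lambda>m. m - W m" and ?D = "\<lambda>m h. h - D m h"
  have bij: "bij_betw ?G ?B ?B"
    by (rule bij_betw_id_minus_contraction[OF WL \<open>0 \<le> L\<close> \<open>L < 1\<close> supp])
  have pos: "0 < det (matrix (?D m))" for m
    by (rule det_id_minus_contraction_pos[OF _ DL \<open>L < 1\<close>])
      (use der has_derivative_linear in blast)
  have "integral ?B (\<lambda>m. \<psi> (?G m) * det (matrix (?D m)))
      = integral ?B (\<lambda>m. \<bar>det (matrix (?D m))\<bar> * \<psi> (?G m))"
    using pos by (intro integral_cong) (simp add: abs_of_pos mult.commute)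
  also have "\<dots> = integral (?G ` ?B) \<psi>"
  proof (rule change_of_variables_real)
    show "(?G has_derivative ?D m) (at m within ?B)" for m
      using has_derivative_at_withinI[OF der] by (intro derivative_intros)
    show "inj_on ?G ?B"
      using bij by (simp add: bij_betw_def)
    show "(\<lambda>m. \<bar>det (matrix (?D m))\<bar> * \<psi> (?G m)) absolutely_integrable_on ?B"
      using pos continuous_on_integrand[OF der cont \<psi>, of ?B]
      by (intro absolutely_integrable_continuous) (simp add: abs_of_pos mult.commute)
  qed auto
  also have "?G ` ?B = ?B"
    using bij by (simp add: bij_betw_def)
  finally show ?thesis .
qed

text \<open>
  The smallness condition on \<open>W\<close> is removed for polynomial integrands: scaling \<open>W\<close> by \<open>t\<close> makes the
  left-hand side a polynomial in \<open>t\<close>, which is constant near \<open>0\<close>.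
\<close>

lemma integral_id_minus_perturbation_polynomial:
  fixes W :: "real^'n::{finite,wellorder} \<Rightarrow> real^'n::_"
  assumes der: "\<And>m. (W has_derivative D m) (at m)"
    and cont: "\<And>h. continuous_on UNIV (\<lambda>m. D m h)"
    and supp: "\<And>m. m \<notin> cbox a b \<Longrightarrow> W m = 0"
    and q: "real_polynomial_function (q :: real^'n::_ \<Rightarrow> real)"
  shows "integral (cbox a b) (\<lambda>m. q (m - W m) * det (matrix (\<lambda>h. h - D m h)))
       = integral (cbox a b) q"
proof -
  let ?B = "cbox a b"
  define h where "h t m = q (m + t *\<^sub>R (- W m)) * det (matrix (\<lambda>h. h - t *\<^sub>R D m h))" for t m
  obtain L where L: "0 < L" "\<And>m h. norm (D m h) \<le> L * norm h"
    "\<And>x y. norm (W x - W y) \<le> L * norm (x - y)"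
    using C1_compact_support_lipschitz[OF der cont compact_cbox supp] by metis
  have W: "continuous_on ?B W"
    using der has_derivative_continuous_on by (metis has_derivative_at_withinI)
  have "poly_family ?B h"
  proof -
    have "matrix (\<lambda>h. h - t *\<^sub>R D m h) $ i $ j = axis j 1 $ i + t * - (D m (axis j 1) $ i)" for t m i j
      by (simp add: matrix_def)
    then have "poly_family ?B (\<lambda>t m. matrix (\<lambda>h. h - t *\<^sub>R D m h) $ i $ j)" for i j
      by (simp only:) (intro poly_family_add poly_family_mult poly_family_parameter
          poly_family_continuous continuous_intros continuous_on_subset[OF cont], auto)
    then show ?thesis
      unfolding h_def
      by (intro poly_family_mult poly_family_det poly_family_real_polynomial[OF q] continuous_intros W)
  qed
  then obtain P where P: "\<And>t. integral ?B (h t) = poly P t"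
    using poly_family_integral by blast
  have "poly P t = integral ?B q" if t: "0 < t" "t < 1 / L" for t
  proof -
    have "integral ?B (\<lambda>m. q (m - t *\<^sub>R W m) * det (matrix (\<lambda>h. h - t *\<^sub>R D m h))) = integral ?B q"
    proof (rule integral_id_minus_small_perturbation[where L = "t * L"])
      show "((\<lambda>m. t *\<^sub>R W m) has_derivative (\<lambda>h. t *\<^sub>R D m h)) (at m)" for m
        using der by (intro derivative_intros)
      show "continuous_on UNIV (\<lambda>m. t *\<^sub>R D m h)" for h
        by (intro continuous_intros cont)
      show "continuous_on UNIV q"
        using q continuous_on_polymonial_function real_polynomial_function_eq by blast
      show "norm (t *\<^sub>R D m h) \<le> t * L * norm h" for m h
        using L(2)[of m h] t by (simp add: mult.assoc)
      show "norm (t *\<^sub>R W x - t *\<^sub>R W y) \<le> t * L * norm (x - y)" for x y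
        using L(3)[of x y] t by (simp add: mult.assoc flip: scaleR_diff_right)
    qed (use supp t L in \<open>auto simp: field_simps\<close>)
    then show ?thesis
      by (simp add: P[symmetric] h_def[abs_def])
  qed
  then have "poly P 1 = integral ?B q"
    using poly_constant_near_0[of "1 / L" P "integral ?B q" 1] L(1) by simp
  then show ?thesis
    by (simp add: P[symmetric] h_def[abs_def])
qed

text \<open>
  The identity carries the degree theory that is needed: it says that \<open>id - W\<close> has degree 1.
\<close>

proposition integral_id_minus_perturbation:
  fixes W :: "real^'n::{finite,wellorder} \<Rightarrow> real^'n::_"
  assumes der: "\<And>m. (W has_derivative D m) (at m)"
    and cont: "\<And>h. continuous_on UNIV (\<lambda>m. D m h)"
    and supp: "\<And>m. m \<notin> cbox a b \<Longrightarrow> W m = 0"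
    and \<psi>: "continuous_on UNIV (\<psi> :: real^'n::_ \<Rightarrow> real)"
  shows "integral (cbox a b) (\<lambda>m. \<psi> (m - W m) * det (matrix (\<lambda>h. h - D m h)))
       = integral (cbox a b) \<psi>"
proof -
  let ?B = "cbox a b" and ?G = "\<lambda>m. m - W m" and ?d = "\<lambda>m. det (matrix (\<lambda>h. h - D m h))"
  let ?I = "\<lambda>\<psi>. integral ?B (\<lambda>m. \<psi> (?G m) * ?d m)"
  define C where "C = integral ?B (\<lambda>m. \<bar>?d m\<bar>) + integral ?B (\<lambda>m. 1::real)"
  have W: "continuous_on ?B W"
    using der has_derivative_continuous_on by (metis has_derivative_at_withinI)
  have d: "continuous_on ?B ?d"
    using continuous_on_integrand[OF der cont, of "\<lambda>_. 1"] by simp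
  have close: "\<bar>?I \<psi> - integral ?B \<psi>\<bar> \<le> e * C" if "0 < e" for e
  proof -
    have "compact (?B \<union> ?G ` ?B)"
      by (intro compact_Un compact_cbox compact_continuous_image continuous_intros W)
    then obtain q where q: "real_polynomial_function q"
      "\<And>x. x \<in> ?B \<union> ?G ` ?B \<Longrightarrow> \<bar>\<psi> x - q x\<bar> < e"
      using Stone_Weierstrass_real_polynomial_function continuous_on_subset[OF \<psi> subset_UNIV] \<open>0 < e\<close>
      by metis
    have qc: "continuous_on UNIV q"
      using q(1) continuous_on_polymonial_function real_polynomial_function_eq by blast
    note int = integrable_continuous[OF continuous_on_integrand[OF der cont]]
    have 1: "\<bar>?I \<psi> - ?I q\<bar> \<le> e * integral ?B (\<lambda>m. \<bar>?d m\<bar>)"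
    proof -
      have "?I \<psi> - ?I q = integral ?B (\<lambda>m. \<psi> (?G m) * ?d m - q (?G m) * ?d m)"
        by (rule integral_diff[symmetric]) (intro int \<psi> qc)+
      also have "norm \<dots> \<le> integral ?B (\<lambda>m. e * \<bar>?d m\<bar>)"
      proof (rule integral_norm_bound_integral)
        show "norm (\<psi> (?G m) * ?d m - q (?G m) * ?d m) \<le> e * \<bar>?d m\<bar>" if "m \<in> ?B" for m
          using q(2)[of "?G m"] that
          by (auto simp: abs_mult simp flip: left_diff_distrib intro!: mult_right_mono)
      qed (intro integrable_diff int \<psi> qc integrable_continuous continuous_intros d)+
      finally show ?thesis by simp
    qed
    have 2: "\<bar>integral ?B \<psi> - integral ?B q\<bar> \<le> e * integral ?B (\<lambda>m. 1)"
    proof -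
      have "integral ?B \<psi> - integral ?B q = integral ?B (\<lambda>m. \<psi> m - q m)"
        by (rule integral_diff[symmetric])
          (intro integrable_continuous continuous_on_subset[OF \<psi>] continuous_on_subset[OF qc] subset_UNIV)+
      also have "norm \<dots> \<le> integral ?B (\<lambda>m. e * 1)"
      proof (rule integral_norm_bound_integral)
        show "norm (\<psi> m - q m) \<le> e * 1" if "m \<in> ?B" for m
          using q(2)[of m] that by auto
      qed (intro integrable_diff integrable_continuous continuous_on_subset[OF \<psi>]
            continuous_on_subset[OF qc] subset_UNIV continuous_intros)+
      finally show ?thesis by (simp add: mult.commute)
    qed
    have "?I q = integral ?B q"
      by (rule integral_id_minus_perturbation_polynomial[OF der cont supp q(1)])
    then show ?thesis
      using 1 2 unfolding C_def distrib_left by linarith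
  qed
  have "C \<ge> 0"
    using close[of 1] by simp
  have "\<bar>?I \<psi> - integral ?B \<psi>\<bar> \<le> e" if "0 < e" for e
  proof -
    have "e / (C + 1) * C \<le> e"
      using \<open>0 \<le> C\<close> \<open>0 < e\<close> by (simp add: field_simps)
    then show ?thesis
      using close[of "e / (C + 1)"] \<open>0 \<le> C\<close> \<open>0 < e\<close> by simp
  qed
  then show ?thesis
    using field_le_epsilon[of "\<bar>?I \<psi> - integral ?B \<psi>\<bar>" 0] by simp
qed

section \<open>Values with preimages of constant sign\<close>

text \<open>
  The inverse function theorem for \<open>id - W\<close>, in the form used to isolate preimages.
\<close>

lemma local_inverse:
  fixes W :: "real^'n \<Rightarrow> real^'n"
  assumes der: "\<And>m. (W has_derivative D m) (at m)"
    and cont: "\<And>h. continuous_on UNIV (\<lambda>m. D m h)"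
    and det: "det (matrix (\<lambda>h. h - D m h)) \<noteq> 0"
    and S: "open S" "m \<in> S"
  obtains N where "open N" "m \<in> N" "N \<subseteq> S" "inj_on (\<lambda>x. x - W x) N" "open ((\<lambda>x. x - W x) ` N)"
proof -
  let ?D = "\<lambda>m h. h - D m h"
  have bl: "bounded_linear (?D x)" for x
    by (intro bounded_linear_sub bounded_linear_ident has_derivative_bounded_linear[OF der])
  have lin: "linear (?D m)"
    using bl bounded_linear.linear by blast
  have inj: "inj (?D m)"
    using det det_nz_iff_inj[OF lin] by blast
  obtain g where g: "linear g" "\<And>h. g (?D m h) = h"
    using linear_injective_left_inverse[OF lin inj] by (metis comp_apply id_apply)
  have blg: "bounded_linear g"
    using g(1) linear_conv_bounded_linear by blast
  have 1: "((\<lambda>x. x - W x) has_derivative blinfun_apply (Blinfun (?D x))) (at x)" for x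
    unfolding bounded_linear_Blinfun_apply[OF bl] using der by (intro derivative_intros)
  have 2: "continuous_on S (\<lambda>x. Blinfun (?D x))"
  proof (rule continuous_on_blinfun_componentwise)
    show "continuous_on S (\<lambda>x. blinfun_apply (Blinfun (?D x)) i)" for i
      unfolding bounded_linear_Blinfun_apply[OF bl]
      by (intro continuous_intros continuous_on_subset[OF cont]) auto
  qed
  have 3: "Blinfun g o\<^sub>L Blinfun (?D m) = id_blinfun"
    by (rule blinfun_eqI) (simp add: bounded_linear_Blinfun_apply bl blg g)
  obtain N V f' where N: "open N" "N \<subseteq> S" "m \<in> N" "open V"
    and hom: "homeomorphism N V (\<lambda>x. x - W x) f'"
    by (rule inverse_function_theorem[OF S(1) 1 2 S(2) 3])
  have "inj_on (\<lambda>x. x - W x) N"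
    by (rule inj_on_inverseI[where g = f']) (rule homeomorphism_apply1[OF hom])
  moreover have "(\<lambda>x. x - W x) ` N = V"
    by (rule homeomorphism_image1[OF hom])
  ultimately show ?thesis using that N by blast
qed

lemma integral_eq_integral_UNIV:
  fixes \<phi> :: "'a::euclidean_space \<Rightarrow> 'b::banach"
  assumes "\<And>x. x \<notin> S \<Longrightarrow> \<phi> x = 0"
  shows "integral S \<phi> = integral UNIV \<phi>"
proof -
  have "(\<lambda>x. if x \<in> S then \<phi> x else 0) = \<phi>"
    using assms by auto
  then show ?thesis
    using integral_restrict_UNIV[of S \<phi>] by simp
qed

text \<open>
  A continuous bump at \<open>y\<close> that is positive exactly on the open ball of radius \<open>e\<close>. It is not
  normalised.
\<close>

definition bump :: "'a::real_normed_vector \<Rightarrow> real \<Rightarrow> 'a \<Rightarrow> real" where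
  "bump y e z = max 0 (e - norm (z - y))"

lemma continuous_on_bump: "continuous_on S (bump y e)"
  unfolding bump_def by (intro continuous_intros)

lemma bump_nonneg: "0 \<le> bump y e z"
  by (simp add: bump_def)

lemma bump_eq_0: "z \<notin> ball y e \<Longrightarrow> bump y e z = 0"
  by (simp add: bump_def dist_norm norm_minus_commute)

lemma integral_bump_pos:
  fixes y :: "'a::euclidean_space"
  assumes "0 < e" "ball y e \<subseteq> cbox a b"
  shows "0 < integral (cbox a b) (bump y e)"
proof -
  have int: "bump y e integrable_on cbox a b"
    by (intro integrable_continuous continuous_on_bump)
  have "y \<in> box a b"
    using assms interior_maximal[of "ball y e" "cbox a b"] by (auto simp: interior_cbox)
  have "integral (cbox a b) (bump y e) \<noteq> 0"
  proof
    assume "integral (cbox a b) (bump y e) = 0"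
    then have "(bump y e has_integral 0) (cbox a b)"
      using int by (metis integrable_integral)
    then have "bump y e y = 0"
      by (intro has_integral_0_cbox_imp_0[of a b])
        (use \<open>y \<in> box a b\<close> box_subset_cbox in \<open>auto intro: continuous_on_bump bump_nonneg\<close>)
    then show False using \<open>0 < e\<close> by (simp add: bump_def)
  qed
  moreover have "0 \<le> integral (cbox a b) (bump y e)"
    by (intro integral_nonneg int) (simp add: bump_nonneg)
  ultimately show ?thesis by simp
qed

text \<open>
  If \<open>\<sigma>\<close> has the sign of the Jacobian determinant at every preimage of \<open>y\<close>, then it still has that
  sign wherever \<open>id - W\<close> takes values close to \<open>y\<close> in the box, so the determinant may be replaced by
  its absolute value. Without preimages the assumption holds for every \<open>\<sigma>\<close>.
\<close>

lemma integral_abs_det_bump: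
  fixes W :: "real^'n::{finite,wellorder} \<Rightarrow> real^'n::_"
  assumes der: "\<And>m. (W has_derivative D m) (at m)"
    and cont: "\<And>h. continuous_on UNIV (\<lambda>m. D m h)"
    and supp: "\<And>m. m \<notin> cbox a b \<Longrightarrow> W m = 0"
    and sign: "\<And>m. m - W m = y \<Longrightarrow> 0 < \<sigma> * det (matrix (\<lambda>h. h - D m h))"
  obtains e1 where "0 < e1" "\<And>e. e \<le> e1 \<Longrightarrow>
    integral (cbox a b) (\<lambda>m. \<bar>det (matrix (\<lambda>h. h - D m h))\<bar> * bump y e (m - W m))
      = sgn \<sigma> * integral (cbox a b) (bump y e)"
proof -
  let ?B = "cbox a b" and ?G = "\<lambda>m. m - W m" and ?d = "\<lambda>m. det (matrix (\<lambda>h. h - D m h))"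
  define Z where "Z = ?B \<inter> {m. \<sigma> * ?d m \<le> 0}"
  have W: "continuous_on UNIV W"
    using der has_derivative_continuous_on by (metis has_derivative_at_withinI)
  have "continuous_on UNIV ?d"
    using continuous_on_integrand[OF der cont, of "\<lambda>_. 1"] by simp
  then have "compact Z"
    unfolding Z_def
    by (intro compact_Int_closed compact_cbox closed_Collect_le continuous_on_mult continuous_on_const)
  \<comment> \<open>\<open>Z\<close> is compact and contains no preimage of \<open>y\<close>\<close>
  obtain e1 where e1: "0 < e1" "\<And>m. m \<in> Z \<Longrightarrow> e1 \<le> norm (?G m - y)"
  proof (cases "Z = {}")
    case True
    then show ?thesis using that[of 1] by simp
  next
    case False
    have "continuous_on Z (\<lambda>m. norm (?G m - y))"
      by (intro continuous_intros continuous_on_subset[OF W]) auto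
    then obtain m0 where m0: "m0 \<in> Z" "\<And>m. m \<in> Z \<Longrightarrow> norm (?G m0 - y) \<le> norm (?G m - y)"
      using continuous_attains_inf[OF \<open>compact Z\<close> False] by blast
    have "?G m0 \<noteq> y"
      using sign[of m0] m0(1) unfolding Z_def by auto
    then show ?thesis
      using that[of "norm (?G m0 - y)"] m0(2) by auto
  qed
  have "integral ?B (\<lambda>m. \<bar>?d m\<bar> * bump y e (?G m)) = sgn \<sigma> * integral ?B (bump y e)"
    if "e \<le> e1" for e
  proof -
    have "\<bar>?d m\<bar> * bump y e (?G m) = sgn \<sigma> * (bump y e (?G m) * ?d m)" if "m \<in> ?B" for m
    proof (cases "bump y e (?G m) = 0")
      case False
      then have "?G m \<in> ball y e"
        using bump_eq_0 by blast
      then have "m \<notin> Z"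
        using e1(2)[of m] \<open>e \<le> e1\<close> by (auto simp: dist_norm norm_minus_commute)
      then have "0 < \<sigma> * ?d m"
        using that unfolding Z_def by auto
      then show ?thesis
        by (auto simp: zero_less_mult_iff)
    qed simp
    then have "integral ?B (\<lambda>m. \<bar>?d m\<bar> * bump y e (?G m))
        = integral ?B (\<lambda>m. sgn \<sigma> * (bump y e (?G m) * ?d m))"
      by (intro integral_cong)
    also have "\<dots> = sgn \<sigma> * integral ?B (\<lambda>m. bump y e (?G m) * ?d m)"
      by simp
    also have "integral ?B (\<lambda>m. bump y e (?G m) * ?d m) = integral ?B (bump y e)"
      by (rule integral_id_minus_perturbation[OF der cont supp continuous_on_bump])
    finally show ?thesis .
  qed
  then show ?thesis using that e1(1) by blast
qed

theorem unique_preimage_of_constant_sign: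
  fixes W :: "real^'n::{finite,wellorder} \<Rightarrow> real^'n::_"
  assumes der: "\<And>m. (W has_derivative D m) (at m)"
    and cont: "\<And>h. continuous_on UNIV (\<lambda>m. D m h)"
    and supp: "\<And>m. R < norm m \<Longrightarrow> W m = 0"
    and sign: "\<And>m. m - W m = y \<Longrightarrow> 0 < \<sigma> * det (matrix (\<lambda>h. h - D m h))"
  shows "\<exists>!m. m - W m = y"
proof -
  let ?G = "\<lambda>m. m - W m" and ?d = "\<lambda>m. det (matrix (\<lambda>h. h - D m h))"
  \<comment> \<open>an open set containing the support of \<open>W\<close>, the point \<open>y\<close> and hence all preimages of \<open>y\<close>\<close>
  define S where "S = ball 0 (R + 1) \<union> ball y 1"
  have "open S" "bounded S"
    unfolding S_def by auto
  then obtain c where c: "S \<subseteq> cbox (- c) c"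
    using bounded_subset_cbox_symmetric by blast
  let ?B = "cbox (- c) c"
  have suppB: "W m = 0" if "m \<notin> ?B" for m
  proof (rule supp)
    have "m \<notin> ball 0 (R + 1)"
      using that c unfolding S_def by blast
    then show "R < norm m" by simp
  qed
  have preimage_S: "m \<in> S" if "?G m = y" for m
    using that supp[of m] unfolding S_def by (cases "R < norm m") auto
  have pos: "0 < integral ?B (bump y e)" if "0 < e" "e \<le> 1" for e
    by (rule integral_bump_pos) (use that c S_def subset_ball[of e 1 y] in auto)
  have ex: "\<exists>m. ?G m = y"
  proof (rule ccontr)
    assume none: "\<not> (\<exists>m. ?G m = y)"
    \<comment> \<open>both signs are admissible, so the integral of the bump equals its own negative\<close>
    obtain e1 where e1: "0 < e1" "\<And>e. e \<le> e1 \<Longrightarrow>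
        integral ?B (\<lambda>m. \<bar>?d m\<bar> * bump y e (?G m)) = sgn 1 * integral ?B (bump y e)"
      by (rule integral_abs_det_bump[OF der cont suppB, where y = y and \<sigma> = 1]) (use none in auto)
    obtain e2 where e2: "0 < e2" "\<And>e. e \<le> e2 \<Longrightarrow>
        integral ?B (\<lambda>m. \<bar>?d m\<bar> * bump y e (?G m)) = sgn (- 1) * integral ?B (bump y e)"
      by (rule integral_abs_det_bump[OF der cont suppB, where y = y and \<sigma> = "- 1"]) (use none in auto)
    define e where "e = min 1 (min e1 e2)"
    have "0 < e" "e \<le> 1" "e \<le> e1" "e \<le> e2"
      using e1(1) e2(1) unfolding e_def by auto
    then show False
      using e1(2)[of e] e2(2)[of e] pos[of e] by simp
  qed
  have "m1 = m2" if m12: "?G m1 = y" "?G m2 = y" for m1 m2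
  proof (rule ccontr)
    assume "m1 \<noteq> m2"
    \<comment> \<open>neighbourhoods of \<open>m1\<close> and \<open>m2\<close> contribute \<open>?J\<close> each, but the total is at most \<open>?J\<close>\<close>
    obtain T1 T2 where T: "open T1" "open T2" "m1 \<in> T1" "m2 \<in> T2" "T1 \<inter> T2 = {}"
      using \<open>m1 \<noteq> m2\<close> hausdorff by metis
    have nz: "?d m1 \<noteq> 0" "?d m2 \<noteq> 0"
      using sign m12 by force+
    obtain N1 where N1: "open N1" "m1 \<in> N1" "N1 \<subseteq> S \<inter> T1" "inj_on ?G N1" "open (?G ` N1)"
      by (rule local_inverse[OF der cont nz(1), of "S \<inter> T1"])
        (use T preimage_S m12 \<open>open S\<close> in \<open>auto intro: open_Int\<close>)
    obtain N2 where N2: "open N2" "m2 \<in> N2" "N2 \<subseteq> S \<inter> T2" "inj_on ?G N2" "open (?G ` N2)"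
      by (rule local_inverse[OF der cont nz(2), of "S \<inter> T2"])
        (use T preimage_S m12 \<open>open S\<close> in \<open>auto intro: open_Int\<close>)
    have "y \<in> ?G ` N1" "y \<in> ?G ` N2"
      using N1(2) N2(2) m12 by (metis image_eqI)+
    then have "open (?G ` N1 \<inter> ?G ` N2)" "y \<in> ?G ` N1 \<inter> ?G ` N2"
      using N1(5) N2(5) by (auto intro: open_Int)
    then obtain e0 where e0: "0 < e0" "ball y e0 \<subseteq> ?G ` N1 \<inter> ?G ` N2"
      using open_contains_ball by metis
    obtain e1 where e1: "0 < e1" "\<And>e. e \<le> e1 \<Longrightarrow>
        integral ?B (\<lambda>m. \<bar>?d m\<bar> * bump y e (?G m)) = sgn \<sigma> * integral ?B (bump y e)"
      using integral_abs_det_bump[OF der cont suppB sign] by blast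
    define e where "e = min 1 (min e0 e1)"
    have e: "0 < e" "e \<le> 1" "e \<le> e0" "e \<le> e1"
      using e0(1) e1(1) unfolding e_def by auto
    let ?F = "\<lambda>m. \<bar>?d m\<bar> * bump y e (?G m)"
    let ?J = "integral ?B (bump y e)"
    have W: "continuous_on UNIV W"
      using der has_derivative_continuous_on by (metis has_derivative_at_withinI)
    have "continuous_on UNIV ?d"
      using continuous_on_integrand[OF der cont, of "\<lambda>_. 1"] by simp
    moreover have "continuous_on UNIV (\<lambda>m. bump y e (?G m))"
      by (rule continuous_on_compose2[OF continuous_on_bump[of UNIV]]) (auto intro!: continuous_intros W)
    ultimately have F: "?F absolutely_integrable_on ?B"
      by (intro absolutely_integrable_continuous_UNIV continuous_intros)
    have bump_out: "bump y e z = 0" if "z \<notin> ball y e" for z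
      using bump_eq_0 that by blast
    have ballB: "ball y e \<subseteq> ?B"
      using e(2) c subset_ball[of e 1 y] unfolding S_def by auto
    have local_integral: "?F integrable_on N \<and> integral N ?F = ?J"
      if N: "open N" "N \<subseteq> S" "inj_on ?G N" "ball y e0 \<subseteq> ?G ` N" for N
    proof -
      have abs: "?F absolutely_integrable_on N"
        by (rule set_integrable_subset[OF F]) (use N c in \<open>auto intro: borel_open\<close>)
      have "integral N ?F = integral (?G ` N) (bump y e)"
      proof (rule change_of_variables_real)
        show "(?G has_derivative (\<lambda>h. h - D m h)) (at m within N)" for m
          using has_derivative_at_withinI[OF der] by (intro derivative_intros)
      qed (use N abs in \<open>auto intro: borel_open\<close>)
      also have "\<dots> = integral UNIV (bump y e)"
        by (rule integral_eq_integral_UNIV) (use bump_out N(4) e(3) subset_ball[of e e0 y] in blast)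
      also have "\<dots> = ?J"
        by (rule integral_eq_integral_UNIV[symmetric]) (use bump_out ballB in blast)
      finally show ?thesis
        using abs set_lebesgue_integral_eq_integral(1) by blast
    qed
    have 1: "?F integrable_on N1" "integral N1 ?F = ?J"
      using local_integral[of N1] N1 e0 by auto
    have 2: "?F integrable_on N2" "integral N2 ?F = ?J"
      using local_integral[of N2] N2 e0 by auto
    have disj: "N1 \<inter> N2 = {}"
      using N1(3) N2(3) T(5) by blast
    have "2 * ?J = integral (N1 \<union> N2) ?F"
      using 1 2 disj by (simp add: integral_Un)
    also have "\<dots> \<le> integral ?B ?F"
    proof (rule integral_subset_le)
      show "?F integrable_on N1 \<union> N2"
        using 1 2 disj by (intro integrable_Un) auto
      show "?F integrable_on ?B"
        using F set_lebesgue_integral_eq_integral(1) by blast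
      show "\<forall>m\<in>?B. 0 \<le> ?F m"
        by (simp add: bump_nonneg)
    qed (use N1(3) N2(3) c in auto)
    also have "\<dots> = sgn \<sigma> * ?J"
      using e1(2) e(4) by blast
    also have "\<dots> \<le> ?J"
      using pos[OF e(1,2)] by (simp add: sgn_if)
    finally show False
      using pos[OF e(1,2)] by simp
  qed
  with ex show ?thesis by blast
qed

section \<open>Zeros of inward-pointing vector fields on the simplex\<close>

lemma prob_simplex_nonneg: "m \<in> prob_simplex \<Longrightarrow> 0 \<le> m $ i"
  and prob_simplex_sum: "m \<in> prob_simplex \<Longrightarrow> (\<Sum>i\<in>UNIV. m $ i) = 1"
  by (simp_all add: prob_simplex_def)

lemma convex_prob_simplex: "convex (prob_simplex :: (real^'n) set)"
  unfolding convex_def prob_simplex_def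
  by (auto simp: sum.distrib simp flip: sum_distrib_left)

lemma norm_prob_simplex_le_1: "m \<in> prob_simplex \<Longrightarrow> norm m \<le> 1"
  using norm_le_l1_cart[of m] by (simp add: prob_simplex_def)

lemma compact_prob_simplex: "compact (prob_simplex :: (real^'n) set)"
proof -
  have "closed (prob_simplex :: (real^'n) set)"
    unfolding prob_simplex_def
    by (intro closed_Collect_conj closed_Collect_all closed_Collect_le closed_Collect_eq continuous_intros)
  moreover have "bounded (prob_simplex :: (real^'n) set)"
    unfolding bounded_iff using norm_prob_simplex_le_1 by blast
  ultimately show ?thesis by (simp add: compact_eq_bounded_closed)
qed

lemma axis_in_prob_simplex: "axis i 1 \<in> prob_simplex"
  by (simp add: prob_simplex_def axis_def)

lemma has_real_derivative_max_0_power2: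
  "((\<lambda>r. (max 0 r)\<^sup>2) has_real_derivative 2 * max 0 r) (at (r::real))"
proof -
  have eq: "(\<lambda>r::real. (max 0 r)\<^sup>2) = (\<lambda>r. if r \<in> {0..} then r\<^sup>2 else 0)"
    by (auto simp: max_def)
  have "((\<lambda>r::real. if r \<in> {0..} then r\<^sup>2 else 0) has_derivative
      (if r \<in> {0..} then (\<lambda>h. 2 * r * h) else (\<lambda>h. 0))) (at r within {0..} \<union> {..0})"
    by (rule has_derivative_If_within_closures[where f' = "\<lambda>r h. 2 * r * h"])
      (auto intro!: derivative_eq_intros)
  moreover have "(if r \<in> {0..} then (\<lambda>h. 2 * r * h) else (\<lambda>h. 0)) = (*) (2 * max 0 r)"
    by (auto simp: max_def)
  moreover have "{0..} \<union> {..0::real} = UNIV"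
    by auto
  ultimately show ?thesis
    unfolding has_field_derivative_def eq by simp
qed

text \<open>
  The condition \<open>nondeg\<close> states injectivity of the differential of \<open>f\<close> on the tangent space of the
  simplex, with the component \<open>z\<close> of the differential left out: the other components determine it,
  because \<open>f\<close> is tangential on the simplex. As \<open>f\<close> is not assumed tangential off the simplex,
  component \<open>z\<close> is corrected in the proof. The index type is well-ordered because the change of
  variables theorem asks for it.
\<close>

theorem unique_zero_on_prob_simplex_wellorder:
  fixes f :: "real^'n::{finite,wellorder} \<Rightarrow> real^'n::_"
  assumes U: "open U" "prob_simplex \<subseteq> U"
    and der: "\<And>p. p \<in> U \<Longrightarrow> (f has_derivative D p) (at p)"
    and cont: "\<And>h. continuous_on U (\<lambda>p. D p h)"
    and inward: "\<And>p i. p \<in> prob_simplex \<Longrightarrow> 0 < p $ i + f p $ i"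
    and tangent: "\<And>p. p \<in> prob_simplex \<Longrightarrow> (\<Sum>i\<in>UNIV. f p $ i) = 0"
    and nondeg: "\<And>p h. p \<in> prob_simplex \<Longrightarrow> (\<Sum>i\<in>UNIV. h $ i) = 0 \<Longrightarrow>
                   (\<And>i. i \<noteq> z \<Longrightarrow> D p h $ i = 0) \<Longrightarrow> h = 0"
  shows "\<exists>!p. p \<in> prob_simplex \<and> f p = 0"
proof -
  let ?K = "prob_simplex :: (real^'n::_) set"
  define s :: "real^'n::_ \<Rightarrow> real" where "s h = (\<Sum>i\<in>UNIV. h $ i)" for h
  define e :: "real^'n::_" where "e = axis z 1"
  have s_linear: "s (x + y) = s x + s y" "s (x - y) = s x - s y" "s (r *\<^sub>R x) = r * s x" for x y r
    unfolding s_def by (simp_all add: sum.distrib sum_subtractf sum_distrib_left)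
  have s_e: "s e = 1"
    unfolding s_def e_def by (simp add: axis_def)
  have s_K: "s p = 1" if "p \<in> ?K" for p
    using that prob_simplex_sum unfolding s_def by blast
  have bl_s: "bounded_linear s"
    unfolding s_def by (intro bounded_linear_sum bounded_linear_vec_nth)
  note der_s = bounded_linear.has_derivative[OF bl_s]
  note cont_s = bounded_linear.continuous_on[OF bl_s]
  \<comment> \<open>projection along \<open>e\<close> onto the affine hyperplane of the simplex, and its linear part\<close>
  define \<pi> where "\<pi> m = m - (s m - 1) *\<^sub>R e" for m
  define \<pi>0 where "\<pi>0 h = h - s h *\<^sub>R e" for h
  have s_\<pi>: "s (\<pi> m) = 1" for m
    unfolding \<pi>_def by (simp add: s_linear s_e)
  have \<pi>_id: "\<pi> m = m" if "s m = 1" for m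
    using that unfolding \<pi>_def by simp
  have der_\<pi>: "(\<pi> has_derivative \<pi>0) (at m)" for m
    unfolding \<pi>_def \<pi>0_def by (auto intro!: derivative_eq_intros der_s)
  have cont_\<pi>: "continuous_on S \<pi>" for S
    unfolding \<pi>_def by (intro continuous_intros cont_s)
  \<comment> \<open>\<open>k\<close> equals \<open>id + f\<close> on the simplex and maps the hyperplane to itself on all of \<open>U\<close>\<close>
  define k where "k p = p + f p - s (f p) *\<^sub>R e" for p
  define Dk where "Dk p h = h + D p h - s (D p h) *\<^sub>R e" for p h
  have s_k: "s (k p) = s p" for p
    unfolding k_def by (simp add: s_linear s_e)
  have k_K: "k p = p + f p" if "p \<in> ?K" for p
    using tangent[OF that] unfolding k_def s_def by simp
  have der_k: "(k has_derivative Dk p) (at p)" if "p \<in> U" for p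
    unfolding k_def Dk_def by (auto intro!: derivative_eq_intros der_s der that)
  have cont_f: "continuous_on U f"
    by (rule has_derivative_continuous_on) (rule has_derivative_at_withinI[OF der])
  have cont_k: "continuous_on U k"
    unfolding k_def by (intro continuous_intros cont_s cont_f)
  have cont_D_comp: "continuous_on S (\<lambda>m. D (g m) v)" if "continuous_on S g" "g ` S \<subseteq> U" for S g v
    by (rule continuous_on_compose2[OF cont that])
  have cont_Dk: "continuous_on S (\<lambda>m. Dk (g m) v)" if "continuous_on S g" "g ` S \<subseteq> U" for S v
    and g :: "real^'n::_ \<Rightarrow> real^'n::_"
    unfolding Dk_def by (intro continuous_intros cont_s cont_D_comp that)
  \<comment> \<open>\<open>k\<close> maps the compact simplex into its relative interior\<close>
  obtain \<delta> where \<delta>: "0 < \<delta>" "\<And>p i. p \<in> ?K \<Longrightarrow> \<delta> \<le> k p $ i"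
  proof -
    have "\<exists>r>0. \<forall>p\<in>?K. r \<le> p $ i + f p $ i" for i
    proof -
      have "continuous_on ?K (\<lambda>p. p $ i + f p $ i)"
        by (intro continuous_intros continuous_on_subset[OF cont_f] U)
      then obtain p0 where "p0 \<in> ?K" "\<forall>p\<in>?K. p0 $ i + f p0 $ i \<le> p $ i + f p $ i"
        using continuous_attains_inf[OF compact_prob_simplex] axis_in_prob_simplex by blast
      then show ?thesis using inward by blast
    qed
    then obtain r where r: "\<And>i. 0 < r i" "\<And>i p. p \<in> ?K \<Longrightarrow> r i \<le> p $ i + f p $ i"
      by metis
    have "Min (range r) \<le> k p $ i" if "p \<in> ?K" for p i
    proof -
      have "Min (range r) \<le> r i"
        by (rule Min_le) auto
      also have "\<dots> \<le> k p $ i"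
        using r(2)[OF that] by (simp add: k_K[OF that])
      finally show ?thesis .
    qed
    moreover have "0 < Min (range r)"
      using r(1) by (simp add: Min_gr_iff)
    ultimately show ?thesis using that by blast
  qed
  define c where "c = k e"
  have "e \<in> ?K"
    unfolding e_def by (rule axis_in_prob_simplex)
  then have c: "\<delta> \<le> c $ i" "s c = 1" for i
    using \<delta>(2) s_K unfolding c_def s_k by auto
  \<comment> \<open>\<open>E\<close> vanishes to second order on the points of the simplex with all coordinates at least \<open>\<delta>\<close>;
    where \<open>E \<le> \<delta>\<^sup>2\<close>, the projection lies in the simplex and \<open>s\<close> is close to 1\<close>
  define E where "E m = (\<Sum>i\<in>UNIV. (max 0 (\<delta> - \<pi> m $ i))\<^sup>2) + (s m - 1)\<^sup>2" for m
  define DE where "DE m h = (\<Sum>i\<in>UNIV. 2 * max 0 (\<delta> - \<pi> m $ i) * (- (\<pi>0 h $ i))) + 2 * (s m - 1) * s h" for m h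
  have der_E: "(E has_derivative DE m) (at m)" for m
  proof -
    have "((\<lambda>m. (max 0 (\<delta> - \<pi> m $ i))\<^sup>2) has_derivative
        (\<lambda>h. 2 * max 0 (\<delta> - \<pi> m $ i) * (- (\<pi>0 h $ i)))) (at m)" for i
    proof -
      have "((\<lambda>m. \<delta> - \<pi> m $ i) has_derivative (\<lambda>h. - (\<pi>0 h $ i))) (at m)"
        by (auto intro!: derivative_eq_intros bounded_linear.has_derivative[OF bounded_linear_vec_nth] der_\<pi>)
      from has_derivative_compose[OF this has_real_derivative_max_0_power2[unfolded has_field_derivative_def]]
      show ?thesis .
    qed
    moreover have "((\<lambda>m. (s m - 1)\<^sup>2) has_derivative (\<lambda>h. 2 * (s m - 1) * s h)) (at m)"
      by (auto intro!: derivative_eq_intros der_s)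
    ultimately show ?thesis
      unfolding E_def DE_def by (intro has_derivative_add has_derivative_sum)
  qed
  have cont_E: "continuous_on S E" for S
    unfolding E_def by (intro continuous_intros cont_s cont_\<pi>)
  have cont_DE: "continuous_on S (\<lambda>m. DE m h)" for S h
    unfolding DE_def by (intro continuous_intros cont_s cont_\<pi>)
  have E_nonneg: "0 \<le> E m" for m
    unfolding E_def by (intro add_nonneg_nonneg sum_nonneg) auto
  have E_le: "(max 0 (\<delta> - \<pi> m $ i))\<^sup>2 \<le> E m" "(s m - 1)\<^sup>2 \<le> E m" for m i
  proof -
    have "(max 0 (\<delta> - \<pi> m $ i))\<^sup>2 \<le> (\<Sum>i\<in>UNIV. (max 0 (\<delta> - \<pi> m $ i))\<^sup>2)"
      by (rule member_le_sum) auto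
    moreover have "0 \<le> (\<Sum>i\<in>UNIV. (max 0 (\<delta> - \<pi> m $ i))\<^sup>2)"
      by (intro sum_nonneg) auto
    moreover have "0 \<le> (s m - 1)\<^sup>2" by simp
    ultimately show "(max 0 (\<delta> - \<pi> m $ i))\<^sup>2 \<le> E m" "(s m - 1)\<^sup>2 \<le> E m"
      unfolding E_def by linarith+
  qed
  have small_E: "\<pi> m \<in> ?K" "\<bar>s m - 1\<bar> \<le> \<delta>" if "E m \<le> \<delta>\<^sup>2" for m
  proof -
    have "0 \<le> \<pi> m $ i" for i
    proof -
      have "(max 0 (\<delta> - \<pi> m $ i))\<^sup>2 \<le> \<delta>\<^sup>2"
        using E_le(1) that order_trans by blast
      then have "max 0 (\<delta> - \<pi> m $ i) \<le> \<delta>"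
        using \<delta>(1) by (simp add: power2_le_iff_abs_le)
      then show ?thesis by simp
    qed
    then show "\<pi> m \<in> ?K"
      using s_\<pi>[of m] unfolding prob_simplex_def s_def by simp
    have "(s m - 1)\<^sup>2 \<le> \<delta>\<^sup>2"
      using E_le(2)[of m] that by linarith
    then show "\<bar>s m - 1\<bar> \<le> \<delta>"
      using \<delta>(1) by (simp add: power2_le_iff_abs_le)
  qed
  have deep: "E m = 0" "DE m h = 0" if "s m = 1" "\<And>i. \<delta> \<le> m $ i" for m h
    using that unfolding E_def DE_def by (simp_all add: \<pi>_id)
  \<comment> \<open>cutoff with value 1 and derivative 0 where \<open>E = 0\<close>, and value 0 where \<open>E \<ge> \<delta>\<^sup>2\<close>\<close>
  define \<eta> where "\<eta> m = (max 0 (1 - E m / \<delta>\<^sup>2))\<^sup>2" for m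
  define D\<eta> where "D\<eta> m h = 2 * max 0 (1 - E m / \<delta>\<^sup>2) * (- (DE m h / \<delta>\<^sup>2))" for m h
  have der_\<eta>: "(\<eta> has_derivative D\<eta> m) (at m)" for m
  proof -
    have "((\<lambda>m. 1 - E m / \<delta>\<^sup>2) has_derivative (\<lambda>h. - (DE m h / \<delta>\<^sup>2))) (at m)"
    proof -
      have "((\<lambda>m. 1 - (1 / \<delta>\<^sup>2) *\<^sub>R E m) has_derivative (\<lambda>h. 0 - (1 / \<delta>\<^sup>2) *\<^sub>R DE m h)) (at m)"
        by (intro has_derivative_diff has_derivative_const has_derivative_scaleR_right der_E)
      then show ?thesis by simp
    qed
    from has_derivative_compose[OF this has_real_derivative_max_0_power2[unfolded has_field_derivative_def]]
    show ?thesis unfolding \<eta>_def D\<eta>_def .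
  qed
  have cont_\<eta>: "continuous_on S \<eta>" for S
    unfolding \<eta>_def using \<delta>(1) by (intro continuous_intros cont_E) auto
  have cont_D\<eta>: "continuous_on S (\<lambda>m. D\<eta> m h)" for S h
    unfolding D\<eta>_def using \<delta>(1) by (intro continuous_intros cont_E cont_DE) auto
  have \<eta>_zero: "\<eta> m = 0" "D\<eta> m h = 0" if "\<delta>\<^sup>2 \<le> E m" for m h
    using that \<delta>(1) unfolding \<eta>_def D\<eta>_def by simp_all
  have \<eta>_bounds: "0 \<le> \<eta> m" "\<eta> m \<le> 1" for m
  proof -
    have "max 0 (1 - E m / \<delta>\<^sup>2) \<le> 1"
      using E_nonneg[of m] by simp
    then show "\<eta> m \<le> 1"
      unfolding \<eta>_def by (simp add: power_le_one)
  qed (simp add: \<eta>_def)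
  have \<eta>_deep: "\<eta> m = 1" "D\<eta> m h = 0" if "s m = 1" "\<And>i. \<delta> \<le> m $ i" for m h
    using deep[OF that] unfolding \<eta>_def D\<eta>_def by simp_all
  \<comment> \<open>\<open>\<pi> m\<close> may leave \<open>U\<close> only where the cutoff vanishes in a neighbourhood\<close>
  define W where "W m = \<eta> m *\<^sub>R (k (\<pi> m) - c)" for m
  define DW where "DW m h = (if \<pi> m \<in> U then \<eta> m *\<^sub>R Dk (\<pi> m) (\<pi>0 h) + D\<eta> m h *\<^sub>R (k (\<pi> m) - c) else 0)" for m h
  have open1: "open (\<pi> -` U)"
    by (rule open_vimage[OF U(1) cont_\<pi>])
  have open2: "open {m. \<delta>\<^sup>2 < E m}"
    by (intro open_Collect_less cont_E continuous_on_const)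
  have cover: "\<pi> -` U \<union> {m. \<delta>\<^sup>2 < E m} = UNIV"
    using small_E(1) U(2) by (force simp: not_less)
  have der_W: "(W has_derivative DW m) (at m)" for m
  proof (cases "\<pi> m \<in> U")
    case True
    have "((\<lambda>m. k (\<pi> m)) has_derivative (\<lambda>h. Dk (\<pi> m) (\<pi>0 h))) (at m)"
      by (rule has_derivative_compose[OF der_\<pi> der_k[OF True]])
    then have "((\<lambda>m. k (\<pi> m) - c) has_derivative (\<lambda>h. Dk (\<pi> m) (\<pi>0 h))) (at m)"
      by (auto intro!: derivative_eq_intros)
    from has_derivative_scaleR[OF der_\<eta> this] show ?thesis
      unfolding W_def[abs_def] DW_def[abs_def] using True by simp
  next
    case False
    have "(W has_derivative (\<lambda>h. 0)) (at m)"
      by (rule has_derivative_transform_within_open[where s = "{m. \<delta>\<^sup>2 < E m}" and f = "\<lambda>_. 0"])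
        (use False cover open2 in \<open>auto simp: W_def \<eta>_zero\<close>)
    then show ?thesis
      using False unfolding DW_def[abs_def] by simp
  qed
  have cont_DW: "continuous_on UNIV (\<lambda>m. DW m h)" for h
  proof -
    have kc: "continuous_on (\<pi> -` U) (\<lambda>m. k (\<pi> m))"
      by (rule continuous_on_compose2[OF cont_k cont_\<pi>]) auto
    have "continuous_on (\<pi> -` U) (\<lambda>m. \<eta> m *\<^sub>R Dk (\<pi> m) (\<pi>0 h) + D\<eta> m h *\<^sub>R (k (\<pi> m) - c))"
      by (intro continuous_intros cont_\<eta> cont_D\<eta> kc cont_Dk cont_\<pi>) auto
    then have "continuous_on (\<pi> -` U) (\<lambda>m. DW m h)"
      by (rule continuous_on_eq) (simp add: DW_def)
    moreover have "continuous_on {m. \<delta>\<^sup>2 < E m} (\<lambda>m. DW m h)"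
      by (rule continuous_on_eq[OF continuous_on_const[of _ 0]]) (simp add: DW_def \<eta>_zero)
    ultimately show ?thesis
      using continuous_on_open_Un[OF open1 open2] cover by metis
  qed
  have supp_W: "W m = 0" if "1 + \<delta> < norm m" for m
  proof (rule ccontr)
    assume "W m \<noteq> 0"
    then have "E m \<le> \<delta>\<^sup>2"
      using \<eta>_zero(1)[of m] unfolding W_def by force
    from small_E[OF this] have "\<pi> m \<in> ?K" "\<bar>s m - 1\<bar> \<le> \<delta>" by auto
    have "m = \<pi> m + (s m - 1) *\<^sub>R e"
      unfolding \<pi>_def by simp
    then have "norm m \<le> norm (\<pi> m) + \<bar>s m - 1\<bar> * norm e"
      using norm_triangle_ineq[of "\<pi> m" "(s m - 1) *\<^sub>R e"] by simp
    also have "\<dots> \<le> 1 + \<delta>"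
      using norm_prob_simplex_le_1[OF \<open>\<pi> m \<in> ?K\<close>] \<open>\<bar>s m - 1\<bar> \<le> \<delta>\<close> by (simp add: e_def norm_axis_1)
    finally show False using that by simp
  qed
  have zero_deep: "s p = 1" "\<And>i. \<delta> \<le> p $ i" if "p \<in> ?K" "f p = 0" for p
    using s_K \<delta>(2) k_K that by force+
  have preimage: "m - W m = c \<longleftrightarrow> m \<in> ?K \<and> f m = 0" for m
  proof
    assume "m - W m = c"
    then have m: "m = c + \<eta> m *\<^sub>R (k (\<pi> m) - c)"
      unfolding W_def by (simp add: algebra_simps)
    have "s m = s c + \<eta> m * (s (k (\<pi> m)) - s c)"
      by (subst m) (simp only: s_linear)
    then have sm: "s m = 1"
      by (simp add: s_k s_\<pi> c)
    \<comment> \<open>otherwise \<open>m = c\<close>, but the cutoff is 1 at \<open>c\<close>\<close>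
    have "\<eta> m \<noteq> 0"
    proof
      assume "\<eta> m = 0"
      then have "m = c" using m by simp
      then show False using \<eta>_deep(1)[of c] c \<open>\<eta> m = 0\<close> by simp
    qed
    then have "m \<in> ?K"
      using small_E(1)[of m] \<eta>_zero(1)[of m] \<pi>_id[OF sm] by force
    \<comment> \<open>\<open>m\<close> is a convex combination of \<open>c\<close> and \<open>k m\<close>, whose coordinates are at least \<open>\<delta>\<close>\<close>
    have "\<delta> \<le> m $ i" for i
    proof -
      have "m $ i = c $ i + \<eta> m * (k m $ i - c $ i)"
        using arg_cong[OF m, of "\<lambda>v. v $ i"] \<pi>_id[OF sm] by simp
      also have "\<dots> = (1 - \<eta> m) * c $ i + \<eta> m * k m $ i"
        by (simp add: algebra_simps)
      also have "\<dots> \<ge> (1 - \<eta> m) * \<delta> + \<eta> m * \<delta>"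
        using \<eta>_bounds[of m] c(1)[of i] \<delta>(2)[OF \<open>m \<in> ?K\<close>, of i]
        by (intro add_mono mult_left_mono) auto
      finally show ?thesis by (simp add: algebra_simps)
    qed
    then have "\<eta> m = 1"
      using \<eta>_deep(1) sm by blast
    then have "m = k m"
      using m \<pi>_id[OF sm] by simp
    then show "m \<in> ?K \<and> f m = 0"
      using k_K[OF \<open>m \<in> ?K\<close>] \<open>m \<in> ?K\<close> by simp
  next
    assume m: "m \<in> ?K \<and> f m = 0"
    then show "m - W m = c"
      using \<eta>_deep(1)[of m] zero_deep[of m] \<pi>_id[of m] k_K[of m] unfolding W_def by simp
  qed
  \<comment> \<open>the differential of \<open>id - W\<close> at preimages of \<open>c\<close>; it is invertible on the whole simplex\<close>
  define N where "N p h = h - Dk p (\<pi>0 h)" for p h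
  have lin_N: "linear (N p)" if "p \<in> ?K" for p
  proof -
    have "((\<lambda>m. m - k (\<pi> m)) has_derivative N p) (at p)"
      unfolding N_def using that U(2) \<pi>_id[OF s_K[OF that]] der_k
      by (intro derivative_intros has_derivative_compose[OF der_\<pi>]) auto
    then show ?thesis by (rule has_derivative_linear)
  qed
  have inj_N: "h = 0" if "p \<in> ?K" "N p h = 0" for p h
  proof -
    let ?v = "D p (\<pi>0 h)"
    have N: "s h *\<^sub>R e - ?v + s ?v *\<^sub>R e = 0"
      using that(2) unfolding N_def Dk_def \<pi>0_def by (simp add: algebra_simps)
    have "s (s h *\<^sub>R e - ?v + s ?v *\<^sub>R e) = s h"
      by (simp add: s_linear s_e)
    then have "s h = 0"
      unfolding N by (simp add: s_def)
    then have "\<pi>0 h = h"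
      unfolding \<pi>0_def by simp
    show "h = 0"
    proof (rule nondeg[OF that(1)])
      show "D p h $ i = 0" if "i \<noteq> z" for i
        using arg_cong[OF N, of "\<lambda>v. v $ i"] that \<open>\<pi>0 h = h\<close> by (simp add: e_def axis_def)
    qed (use \<open>s h = 0\<close> in \<open>simp add: s_def\<close>)
  qed
  define d where "d p = det (matrix (N p))" for p
  have d_nz: "d p \<noteq> 0" if "p \<in> ?K" for p
    using inj_N[OF that] linear_injective_0[OF lin_N[OF that]] det_nz_iff_inj[OF lin_N[OF that]]
    unfolding d_def by blast
  have "continuous_on ?K d"
    unfolding d_def N_def
    by (intro continuous_on_det continuous_on_matrix continuous_intros cont_Dk) (use U in auto)
  then have "connected (d ` ?K)"
    by (intro connected_continuous_image convex_connected convex_prob_simplex)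
  then have sign: "0 < d e * d p" if "p \<in> ?K" for p
    using d_nz \<open>e \<in> ?K\<close> that unfolding connected_iff_interval
    by (smt (verit) imageE imageI zero_less_mult_iff)
  have "\<exists>!m. m - W m = c"
  proof (rule unique_preimage_of_constant_sign[OF der_W cont_DW supp_W, where \<sigma> = "d e"])
    fix m assume "m - W m = c"
    then have m: "m \<in> ?K" "f m = 0" using preimage by auto
    have "DW m h = Dk m (\<pi>0 h)" for h
      using \<eta>_deep[OF zero_deep[OF m]] \<pi>_id[OF s_K] m(1) U(2) unfolding DW_def by auto
    then show "0 < d e * det (matrix (\<lambda>h. h - DW m h))"
      using sign[OF m(1)] unfolding d_def N_def by simp
  qed
  then show ?thesis unfolding preimage .
qed

text \<open>
  A copy of the type \<open>'a\<close> that can carry an order of its own, so that results on \<open>real^'n\<close> with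
  well-ordered \<open>'n\<close> carry over to arbitrary finite index types. The order is the one transported
  from an injection into the natural numbers.
\<close>

typedef 'a ord_copy = "UNIV :: 'a set" by simp

lemma bij_Rep_ord_copy: "bij Rep_ord_copy"
  by (metis Abs_ord_copy_inverse Rep_ord_copy_inverse UNIV_I bijI')

instantiation ord_copy :: (finite) linorder
begin

definition "x \<le> y \<longleftrightarrow> to_nat (Rep_ord_copy x) \<le> to_nat (Rep_ord_copy y)"

definition "x < y \<longleftrightarrow> to_nat (Rep_ord_copy x) < to_nat (Rep_ord_copy y)"

instance
  by intro_classes (auto simp: less_ord_copy_def less_eq_ord_copy_def Rep_ord_copy_inject)

end

instance ord_copy :: (finite) wellorder
proof (rule wf_wellorderI)
  have "{(x :: 'a ord_copy, y). x < y} = inv_image less_than (\<lambda>x. to_nat (Rep_ord_copy x))"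
    by (auto simp: less_ord_copy_def)
  then show "wf {(x :: 'a ord_copy, y). x < y}"
    by (simp only: wf_inv_image wf_less_than)
qed intro_classes

instance ord_copy :: (finite) finite
proof
  show "finite (UNIV :: 'a ord_copy set)"
    using bij_Rep_ord_copy bij_betw_finite finite by blast
qed

theorem unique_zero_on_prob_simplex:
  fixes f :: "real^'s \<Rightarrow> real^'s"
  assumes U: "open U" "prob_simplex \<subseteq> U"
    and der: "\<And>p. p \<in> U \<Longrightarrow> (f has_derivative D p) (at p)"
    and cont: "\<And>h. continuous_on U (\<lambda>p. D p h)"
    and inward: "\<And>p i. p \<in> prob_simplex \<Longrightarrow> 0 < p $ i + f p $ i"
    and tangent: "\<And>p. p \<in> prob_simplex \<Longrightarrow> (\<Sum>i\<in>UNIV. f p $ i) = 0"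
    and nondeg: "\<And>p h. p \<in> prob_simplex \<Longrightarrow> (\<Sum>i\<in>UNIV. h $ i) = 0 \<Longrightarrow>
                   (\<And>i. i \<noteq> z \<Longrightarrow> D p h $ i = 0) \<Longrightarrow> h = 0"
  shows "\<exists>!p. p \<in> prob_simplex \<and> f p = 0"
proof -
  \<comment> \<open>reindexing of the coordinates by the ordered copy, and its inverse\<close>
  define \<rho> :: "real^'s \<Rightarrow> real^'s ord_copy" where "\<rho> p = (\<chi> i. p $ Rep_ord_copy i)" for p
  define \<kappa> :: "real^'s ord_copy \<Rightarrow> real^'s" where "\<kappa> q = (\<chi> i. q $ Abs_ord_copy i)" for q
  have inv: "\<rho> (\<kappa> q) = q" "\<kappa> (\<rho> p) = p" for p q
    unfolding \<rho>_def \<kappa>_def by (simp_all add: vec_eq_iff Rep_ord_copy_inverse Abs_ord_copy_inverse)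
  have \<rho>_nth: "\<rho> p $ i = p $ Rep_ord_copy i" for p i
    unfolding \<rho>_def by simp
  have \<kappa>_nth: "\<kappa> q $ Rep_ord_copy i = q $ i" for q i
    unfolding \<kappa>_def by (simp add: Rep_ord_copy_inverse)
  have lin: "linear \<rho>" "linear \<kappa>"
    unfolding \<rho>_def \<kappa>_def by (intro linearI; simp add: vec_eq_iff)+
  note bl = lin[THEN linear_conv_bounded_linear[THEN iffD1]]
  have cont_\<kappa>: "continuous_on S \<kappa>" for S
    by (rule linear_continuous_on[OF bl(2)])
  have sum: "(\<Sum>i\<in>UNIV. \<kappa> q $ i) = (\<Sum>i\<in>UNIV. q $ i)" for q
    using sum.reindex_bij_betw[OF bij_Rep_ord_copy, of "\<lambda>i. \<kappa> q $ i"] by (simp add: \<kappa>_nth)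
  have nth: "\<kappa> q $ i = q $ Abs_ord_copy i" for q i
    unfolding \<kappa>_def by simp
  have K: "\<kappa> q \<in> prob_simplex \<longleftrightarrow> q \<in> prob_simplex" for q
    unfolding prob_simplex_def mem_Collect_eq sum
    by (metis \<kappa>_nth nth)
  have "\<exists>!q. q \<in> prob_simplex \<and> \<rho> (f (\<kappa> q)) = 0"
  proof (rule unique_zero_on_prob_simplex_wellorder[where U = "\<kappa> -` U" and z = "Abs_ord_copy z"
        and D = "\<lambda>q h. \<rho> (D (\<kappa> q) (\<kappa> h))"])
    show "open (\<kappa> -` U)"
      by (rule open_vimage[OF U(1) cont_\<kappa>])
    show "prob_simplex \<subseteq> \<kappa> -` U"
      using K U(2) by blast
    show "((\<lambda>q. \<rho> (f (\<kappa> q))) has_derivative (\<lambda>h. \<rho> (D (\<kappa> q) (\<kappa> h)))) (at q)" if "q \<in> \<kappa> -` U" for q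
    proof -
      have "((\<lambda>q. f (\<kappa> q)) has_derivative (\<lambda>h. D (\<kappa> q) (\<kappa> h))) (at q)"
        by (rule has_derivative_compose[OF bounded_linear_imp_has_derivative[OF bl(2)] der])
          (use that in simp)
      then show ?thesis
        by (rule bounded_linear.has_derivative[OF bl(1)])
    qed
    show "continuous_on (\<kappa> -` U) (\<lambda>q. \<rho> (D (\<kappa> q) (\<kappa> h)))" for h
      by (intro bounded_linear.continuous_on[OF bl(1)] continuous_on_compose2[OF cont cont_\<kappa>]) auto
    show "0 < q $ i + \<rho> (f (\<kappa> q)) $ i" if "q \<in> prob_simplex" for q i
      using inward[of "\<kappa> q" "Rep_ord_copy i"] that K by (simp add: \<kappa>_nth \<rho>_nth)
    show "(\<Sum>i\<in>UNIV. \<rho> (f (\<kappa> q)) $ i) = 0" if "q \<in> prob_simplex" for q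
      using tangent[of "\<kappa> q"] that K sum[of "\<rho> (f (\<kappa> q))"] by (simp add: inv)
    show "h = 0" if q: "q \<in> prob_simplex" and h: "(\<Sum>i\<in>UNIV. h $ i) = 0"
      and D: "\<And>i. i \<noteq> Abs_ord_copy z \<Longrightarrow> \<rho> (D (\<kappa> q) (\<kappa> h)) $ i = 0" for q h
    proof -
      have "D (\<kappa> q) (\<kappa> h) $ i = 0" if "i \<noteq> z" for i
        using D[of "Abs_ord_copy i"] that by (simp add: \<rho>_nth Abs_ord_copy_inject Abs_ord_copy_inverse)
      then have "\<kappa> h = 0"
        using nondeg[of "\<kappa> q" "\<kappa> h"] q h K sum by metis
      then show "h = 0"
        by (metis inv(1) lin(1) linear_0)
    qed
  qed
  moreover have "\<rho> (f (\<kappa> q)) = 0 \<longleftrightarrow> f (\<kappa> q) = 0" for q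
    by (metis inv(2) lin linear_0)
  ultimately have "\<exists>!q. \<kappa> q \<in> prob_simplex \<and> f (\<kappa> q) = 0"
    by (simp add: K)
  then show ?thesis
    by (metis inv)
qed

section \<open>Stationary distributions of irreducible generators\<close>

text \<open>
  A vanishing coordinate of a stationary vector with non-negative entries propagates backwards along
  jumps of positive rate, hence to all states.
\<close>

lemma stationary_vanishes:
  fixes A :: "real^'s^'s"
  assumes A: "transition_rate_matrix A" "irreducible_generator A"
    and x: "\<And>i. 0 \<le> x $ i" "x v* A = 0" and i: "x $ i = 0"
  shows "x = 0"
proof -
  have step: "x $ k = 0" if "x $ l = 0" "k \<noteq> l" "0 < A $ k $ l" for k l
  proof -
    have "0 \<le> A $ j $ l * x $ j" for j
      using A(1) x(1) that(1) unfolding transition_rate_matrix_def by (cases "j = l") auto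
    moreover have "(\<Sum>j\<in>UNIV. A $ j $ l * x $ j) = 0"
      using arg_cong[OF x(2), of "\<lambda>v. v $ l"] by (simp add: vector_matrix_mult_def mult.commute)
    ultimately have "A $ k $ l * x $ k = 0"
      by (simp add: sum_nonneg_eq_0_iff)
    then show ?thesis using that(3) by simp
  qed
  have "x $ k = 0" for k
  proof -
    have "(k, i) \<in> {(k, l). k \<noteq> l \<and> 0 < A $ k $ l}\<^sup>*"
      using A(2) unfolding irreducible_generator_def by blast
    then show ?thesis
      by (induction rule: converse_rtrancl_induct) (use i step in auto)
  qed
  then show ?thesis by (simp add: vec_eq_iff)
qed

lemma stationary_positive:
  fixes A :: "real^'s^'s"
  assumes A: "transition_rate_matrix A" "irreducible_generator A"
    and x: "x \<in> prob_simplex" "x v* A = 0"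
  shows "0 < x $ i"
proof (rule ccontr)
  assume "\<not> 0 < x $ i"
  then have "x $ i = 0"
    using prob_simplex_nonneg[OF x(1), of i] by simp
  then have "x = 0"
    using stationary_vanishes[OF A _ x(2)] prob_simplex_nonneg[OF x(1)] by blast
  then show False
    using prob_simplex_sum[OF x(1)] by simp
qed

text \<open>
  A stationary distribution is a fixed point of the stochastic matrix \<open>I + A / r\<close>, where \<open>r\<close> bounds
  the exit rates.
\<close>

lemma stationary_exists:
  fixes A :: "real^'s^'s"
  assumes A: "transition_rate_matrix A"
  shows "\<exists>x\<in>prob_simplex. x v* A = 0"
proof -
  define r where "r = (\<Sum>i\<in>UNIV. \<bar>A $ i $ i\<bar>) + 1"
  have r: "\<bar>A $ i $ i\<bar> \<le> r" for i
    using member_le_sum[of i UNIV "\<lambda>i. \<bar>A $ i $ i\<bar>"] unfolding r_def by simp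
  have "0 < r"
    unfolding r_def by (intro add_nonneg_pos sum_nonneg) auto
  define F where "F x = x + (1 / r) *\<^sub>R (x v* A)" for x
  have F_nth: "F x $ j = x $ j + (\<Sum>i\<in>UNIV. A $ i $ j * x $ i) / r" for x j
    unfolding F_def by (simp add: vector_matrix_mult_def mult.commute)
  have "F x \<in> prob_simplex" if x: "x \<in> prob_simplex" for x
  proof -
    have "0 \<le> F x $ j" for j
    proof -
      have "A $ j $ j * x $ j \<le> (\<Sum>i\<in>UNIV. A $ i $ j * x $ i)"
      proof -
        have "0 \<le> (\<Sum>i\<in>UNIV - {j}. A $ i $ j * x $ i)"
          using A prob_simplex_nonneg[OF x] unfolding transition_rate_matrix_def
          by (intro sum_nonneg mult_nonneg_nonneg) auto
        then show ?thesis by (simp add: sum.remove[of UNIV j])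
      qed
      moreover have "- r * x $ j \<le> A $ j $ j * x $ j"
        using r[of j] prob_simplex_nonneg[OF x, of j] by (intro mult_right_mono) auto
      ultimately have "- r * x $ j / r \<le> (\<Sum>i\<in>UNIV. A $ i $ j * x $ i) / r"
        using \<open>0 < r\<close> by (intro divide_right_mono) auto
      then show ?thesis
        using \<open>0 < r\<close> by (simp add: F_nth)
    qed
    moreover have "(\<Sum>j\<in>UNIV. \<Sum>i\<in>UNIV. A $ i $ j * x $ i) = 0"
    proof -
      have "(\<Sum>j\<in>UNIV. \<Sum>i\<in>UNIV. A $ i $ j * x $ i) = (\<Sum>i\<in>UNIV. (\<Sum>j\<in>UNIV. A $ i $ j) * x $ i)"
        by (subst sum.swap) (simp add: sum_distrib_right)
      then show ?thesis
        using A unfolding transition_rate_matrix_def by simp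
    qed
    ultimately show ?thesis
      using prob_simplex_sum[OF x] unfolding prob_simplex_def
      by (simp add: F_nth sum.distrib flip: sum_divide_distrib)
  qed
  moreover have "continuous_on prob_simplex F"
    unfolding F_def vector_matrix_mult_def by (intro continuous_intros)
  moreover have "prob_simplex \<noteq> ({} :: (real^'s) set)"
    using axis_in_prob_simplex by blast
  ultimately obtain x where "x \<in> prob_simplex" "F x = x"
    using brouwer[OF compact_prob_simplex convex_prob_simplex, of F] by blast
  then show ?thesis
    using \<open>0 < r\<close> unfolding F_def by auto
qed

lemma stationary_unique:
  fixes A :: "real^'s^'s"
  assumes A: "transition_rate_matrix A" "irreducible_generator A"
    and x: "x \<in> prob_simplex" "x v* A = 0" and y: "y \<in> prob_simplex" "y v* A = 0"
  shows "x = y"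
proof -
  \<comment> \<open>\<open>q\<close> is the largest factor with \<open>q y \<le> x\<close>; then \<open>x - q y\<close> has a vanishing coordinate\<close>
  define q where "q = Min (range (\<lambda>i. x $ i / y $ i))"
  have "q \<in> range (\<lambda>i. x $ i / y $ i)"
    unfolding q_def by (rule Min_in) auto
  then obtain i where i: "q = x $ i / y $ i" by blast
  have y_pos: "0 < y $ j" for j
    by (rule stationary_positive[OF A y])
  have "q \<le> x $ j / y $ j" for j
    unfolding q_def by (rule Min_le) auto
  then have nonneg: "0 \<le> (x - q *\<^sub>R y) $ j" for j
    using y_pos[of j] by (simp flip: pos_le_divide_eq)
  have "x - q *\<^sub>R y = 0"
  proof (rule stationary_vanishes[OF A nonneg])
    have "(x - q *\<^sub>R y) v* A = x v* A - q *\<^sub>R (y v* A)"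
      by (simp add: vec_eq_iff vector_matrix_mult_def left_diff_distrib sum_subtractf
          sum_distrib_left mult.assoc)
    then show "(x - q *\<^sub>R y) v* A = 0"
      using x y by simp
    show "(x - q *\<^sub>R y) $ i = 0"
      using y_pos[of i] by (simp add: i)
  qed
  then have xy: "x = q *\<^sub>R y" by simp
  have "1 = q * 1"
    using prob_simplex_sum[OF x(1)] prob_simplex_sum[OF y(1)]
    by (simp add: xy flip: sum_distrib_left)
  then show ?thesis using xy by simp
qed

lemma stationary_distribution:
  fixes A :: "real^'s^'s"
  assumes A: "transition_rate_matrix A" "irreducible_generator A"
  shows "stationary_distribution A \<in> prob_simplex" "stationary_distribution A v* A = 0"
    and "x \<in> prob_simplex \<Longrightarrow> 0 = x v* A \<longleftrightarrow> x = stationary_distribution A"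
proof -
  have "\<exists>!x. x \<in> prob_simplex \<and> 0 = x v* A"
    using stationary_exists[OF A(1)] stationary_unique[OF A] by metis
  from theI'[OF this]
  show 1: "stationary_distribution A \<in> prob_simplex" "stationary_distribution A v* A = 0"
    unfolding stationary_distribution_def by auto
  show "0 = x v* A \<longleftrightarrow> x = stationary_distribution A" if "x \<in> prob_simplex"
    using stationary_unique[OF A that _ 1] 1 by metis
qed

section \<open>Invariant distributions of the nonlinear chain\<close>

text \<open>
  On the tangent space, \<open>h\<close> is determined by its first \<open>S - 1\<close> components, and the matrix \<open>M\<close> describes
  the first \<open>S - 1\<close> components of the differential in terms of them.
\<close>

lemma reduced_jacobian_kernel:
  fixes st :: "nat \<Rightarrow> 's::finite" and h :: "real^'s"
  assumes st: "bij_betw st {1..CARD('s)} UNIV"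
    and inv: "invertible_mat (reduced_jacobian st f m)"
    and sum: "(\<Sum>i\<in>UNIV. h $ i) = 0"
    and zero: "\<And>i. i \<noteq> st CARD('s) \<Longrightarrow> (jacobian f (at m) *v h) $ i = 0"
  shows "h = 0"
proof -
  define n where "n = CARD('s) - 1"
  have card: "CARD('s) = Suc n"
    unfolding n_def by simp
  let ?J = "jacobian f (at m)" and ?z = "st (Suc n)"
  let ?R = "reduced_jacobian st f m"
  have R: "?R = Matrix.mat n n (\<lambda>(i, j). ?J $ st (i + 1) $ st (j + 1) - ?J $ st (i + 1) $ ?z)"
    unfolding reduced_jacobian_def Let_def card by simp
  then have R_carrier: "?R \<in> carrier_mat n n"
    by simp
  have split: "(\<Sum>k\<in>UNIV. g k) = (\<Sum>j<n. g (st (j + 1))) + g ?z" for g :: "'s \<Rightarrow> real"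
  proof -
    have "(\<Sum>k\<in>UNIV. g k) = (\<Sum>k=1..Suc n. g (st k))"
      using sum.reindex_bij_betw[OF st, of g] by (simp add: card)
    then show ?thesis
      by (simp add: sum.atLeast1_atMost_eq)
  qed
  define v where "v = Matrix.vec n (\<lambda>j. h $ st (j + 1))"
  have v: "v \<in> carrier_vec n"
    unfolding v_def by simp
  have "?R *\<^sub>v v = 0\<^sub>v n"
  proof (rule eq_vecI)
    fix i assume "i < dim_vec (0\<^sub>v n :: real Matrix.vec)"
    then have i: "i < n" by simp
    have "Suc i \<noteq> Suc n" "Suc i \<in> {1..CARD('s)}" "Suc n \<in> {1..CARD('s)}"
      using i card by auto
    then have "st (i + 1) \<noteq> ?z"
      using inj_on_contraD[OF bij_betw_imp_inj_on[OF st]] by (metis Suc_eq_plus1)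
    then have "(?J *v h) $ st (i + 1) = 0"
      by (rule zero[unfolded card])
    then have "0 = (\<Sum>k\<in>UNIV. ?J $ st (i + 1) $ k * h $ k)"
      unfolding matrix_vector_mult_def by simp
    also have "\<dots> = (\<Sum>j<n. ?J $ st (i + 1) $ st (j + 1) * h $ st (j + 1)) + ?J $ st (i + 1) $ ?z * h $ ?z"
      by (rule split)
    also have "h $ ?z = - (\<Sum>j<n. h $ st (j + 1))"
      using sum split[of "\<lambda>k. h $ k"] by simp
    finally have "(\<Sum>j<n. (?J $ st (i + 1) $ st (j + 1) - ?J $ st (i + 1) $ ?z) * h $ st (j + 1)) = 0"
      by (simp add: left_diff_distrib sum_subtractf sum_distrib_left)
    then show "Matrix.vec_index (?R *\<^sub>v v) i = Matrix.vec_index (0\<^sub>v n) i"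
      using i unfolding R v_def by (simp add: scalar_prod_def atLeast0LessThan)
  qed (use R_carrier in auto)
  note Rv = this
  obtain B where B: "inverts_mat ?R B" "inverts_mat B ?R"
    using inv unfolding invertible_mat_def by blast
  have B_carrier: "B \<in> carrier_mat n n"
  proof
    show "dim_row B = n"
      using arg_cong[OF B(2)[unfolded inverts_mat_def], of dim_col] R_carrier by simp
    show "dim_col B = n"
      using arg_cong[OF B(1)[unfolded inverts_mat_def], of dim_col] R_carrier by simp
  qed
  have "v = (B * ?R) *\<^sub>v v"
    using B(2) B_carrier v unfolding inverts_mat_def by simp
  also have "\<dots> = B *\<^sub>v (?R *\<^sub>v v)"
    by (rule assoc_mult_mat_vec[OF B_carrier R_carrier v])
  finally have "v = B *\<^sub>v 0\<^sub>v n"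
    unfolding Rv .
  then have v0: "v = 0\<^sub>v n"
    using B_carrier by (auto intro!: eq_vecI simp: scalar_prod_def)
  have first: "h $ st (j + 1) = 0" if "j < n" for j
    using arg_cong[OF v0, of "\<lambda>v. Matrix.vec_index v j"] that by (simp add: v_def)
  then have last: "h $ ?z = 0"
    using sum split[of "\<lambda>k. h $ k"] by simp
  have "h $ k = 0" for k
  proof -
    obtain j where "j \<in> {1..Suc n}" "k = st j"
      using bij_betw_imp_surj_on[OF st] card by (metis UNIV_I image_iff)
    then show ?thesis
      using first[of "j - 1"] last by (cases "j = Suc n") auto
  qed
  then show ?thesis by (simp add: vec_eq_iff)
qed

lemma invariant_distribution_iff:
  assumes "is_nonlinear_generator P Q"
  shows "invariant_distribution P m \<longleftrightarrow> m \<in> prob_simplex \<and> 0 = m v* Q m"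
proof (cases "m \<in> prob_simplex")
  case True
  let ?F = "at 0 within {0::real..}"
  have "((\<lambda>t. marginal_flow P t m $ j) has_real_derivative (m v* Q m) $ j) ?F" for j
    using assms True unfolding is_nonlinear_generator_def
    by (simp add: vector_matrix_mult_def mult.commute)
  then have flow: "((\<lambda>t. marginal_flow P t m) has_vector_derivative (m v* Q m)) ?F"
    unfolding has_vector_derivative_def
    by (subst has_derivative_componentwise_within)
      (auto simp: Basis_vec_def inner_axis has_field_derivative_def mult_commute_abs)
  have "?F \<noteq> bot"
    by (simp add: at_within_Ici_at_right)
  then show ?thesis
    using True flow vector_derivative_unique_within unfolding invariant_distribution_def by metis
qed (simp add: invariant_distribution_def)

theorem theorem3p2:
  fixes st :: "nat \<Rightarrow> 's::finite"
    and P :: "real \<Rightarrow> real ^ 's \<Rightarrow> real ^ 's ^ 's"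
    and Q :: "real ^ 's \<Rightarrow> real ^ 's ^ 's"
    and f :: "real ^ 's \<Rightarrow> real ^ 's"
    and U :: "(real ^ 's) set"
  assumes "bij_betw st {1..CARD('s)} UNIV"
    and "nonlinear_transition_probs P"
    and "is_nonlinear_generator P Q"
    and "\<forall>m\<in>prob_simplex. irreducible_generator (Q m)"
    and "open U" and "prob_simplex \<subseteq> U"
    and "continuously_differentiable_on f U"
    and "\<forall>m\<in>prob_simplex. f m = stationary_distribution (Q m) - m"
    and "\<forall>m\<in>prob_simplex. invertible_mat (reduced_jacobian st f m)"
  shows "(\<exists>!m. invariant_distribution P m) \<and> (\<exists>!m. m \<in> prob_simplex \<and> 0 = m v* Q m)"
proof -
  have rate: "transition_rate_matrix (Q m)" if "m \<in> prob_simplex" for m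
    using assms(3) that unfolding is_nonlinear_generator_def by blast
  note irr = assms(4)[rule_format]
  note stat = stationary_distribution[OF rate irr]
  have f: "m + f m = stationary_distribution (Q m)" if "m \<in> prob_simplex" for m
    using assms(8) that by simp
  have "\<exists>!m. m \<in> prob_simplex \<and> f m = 0"
  proof (rule unique_zero_on_prob_simplex[OF assms(5,6), where z = "st CARD('s)"])
    show "(f has_derivative (\<lambda>h. jacobian f (at m) *v h)) (at m)" if "m \<in> U" for m
      using assms(7) that jacobian_works unfolding continuously_differentiable_on_def by blast
    show "continuous_on U (\<lambda>m. jacobian f (at m) *v h)" for h
      using assms(7) unfolding continuously_differentiable_on_def matrix_vector_mult_def
      by (intro continuous_intros) auto
    show "0 < m $ i + f m $ i" if "m \<in> prob_simplex" for m i
      using stationary_positive[OF rate irr stat(1,2), of m i] that f[OF that, symmetric] by simp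
    show "(\<Sum>i\<in>UNIV. f m $ i) = 0" if "m \<in> prob_simplex" for m
      using assms(8) that prob_simplex_sum[OF that] prob_simplex_sum[OF stat(1)[OF that that]]
      by (simp add: sum_subtractf)
    show "h = 0" if "m \<in> prob_simplex" "(\<Sum>i\<in>UNIV. h $ i) = 0"
      "\<And>i. i \<noteq> st CARD('s) \<Longrightarrow> (jacobian f (at m) *v h) $ i = 0" for m h
      using reduced_jacobian_kernel[OF assms(1)] assms(9) that by blast
  qed
  moreover have "m \<in> prob_simplex \<and> f m = 0 \<longleftrightarrow> m \<in> prob_simplex \<and> 0 = m v* Q m" for m
    using stat(3)[of m m] assms(8) by auto
  ultimately show ?thesis
    by (simp add: invariant_distribution_iff[OF assms(3)])
qed

end
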